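(* Let $m,p,q\ge 1$ be integers, let $\mathcal H$ be a complex Hilbert space (of finite or infinite dimension), and let $\mathbf A=(A_1,\dots,A_m)$ be an $m$-tuple of bounded linear operators on $\mathcal H$ (not necessarily self-adjoint). (1) Set $p_1=2pq(m+1)$. If $\dim\mathcal H\ge(p_1-1)(2m+1)^2$, then $\Lambda_{p_1}(\mathbf A)$ is non-empty, $\Lambda_{p,q}(\mathbf A)$ is star-shaped, and $(c_1I_q,\dots,c_mI_q)$ is a star-center of $\Lambda_{p,q}(\mathbf A)$ for all $(c_1,\dots,c_m)\in\Lambda_{p_1}(\mathbf A)$. (2) Set $p_2=p(q^2(2m+1)+1)$. If $\dim\mathcal H\ge(p_2q-1)(2m+1)^2$, then $\Lambda_{p_2,q}(\mathbf A)$ is non-empty, $\Lambda_{p,q}(\mathbf A)$ is star-shaped, and $(C_1,\dots,C_m)$ is a star-center of $\Lambda_{p,q}(\mathbf A)$ for all $(C_1,\dots,C_m)\in\Lambda_{p_2,q}(\mathbf A)$.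
   Context: Let $\mathbf M_q$ be the space of $q\times q$ complex matrices. For bounded operators $\mathbf A=(A_1,\dots,A_m)$ on a complex Hilbert space $\mathcal H$ and positive integers $p,q$, the joint $(p,q)$-matricial range $\Lambda_{p,q}(\mathbf A)$ is the set of all $(B_1,\dots,B_m)\in\mathbf M_q^m$ for which there is a linear isometry $X:\mathbb C^p\otimes\mathbb C^q\to\mathcal H$ with $X^*A_jX=I_p\otimes B_j$ for all $j=1,\dots,m$ (the same $X$ for all $j$). For a positive integer $k$, the joint rank $k$-numerical range $\Lambda_k(\mathbf A)$ is the set of $(b_1,\dots,b_m)\in\mathbb C^m$ for which there is a linear isometry $X:\mathbb C^k\to\mathcal H$ with $X^*A_jX=b_jI_k$ for all $j$. A subset $S$ of a real or complex vector space is star-shaped if there is $s_0\in S$ with $ts_0+(1-t)s\in S$ for all $s\in S$ and $0\le t\le1$; such an $s_0$ is called a star-center of $S$. *)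

theory Defs
  imports Complex_Main "HOL-Library.Extended_Nat" "Jordan_Normal_Form.Matrix"
begin

section \<open>Complex Hilbert spaces\<close>

text \<open>
  A complex Hilbert space is a Banach space (completeness comes from the class \<^class>\<open>banach\<close>)
  whose real scalar multiplication extends to a complex one and whose norm is induced by a complex
  inner product.  The inner product is linear in the first argument, like \<^term>\<open>(\<bullet>c)\<close> on vectors
  of \<open>C^n\<close>.  Positive definiteness follows from \<open>cinner_self\<close> and the norm axioms.
\<close>

class complex_hilbert_space = banach +
  fixes scaleC :: "complex \<Rightarrow> 'a \<Rightarrow> 'a" (infixr "*\<^sub>C" 75)
    and cinner :: "'a \<Rightarrow> 'a \<Rightarrow> complex"
  assumes scaleR_scaleC: "r *\<^sub>R x = complex_of_real r *\<^sub>C x"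
    and scaleC_add_right: "a *\<^sub>C (x + y) = a *\<^sub>C x + a *\<^sub>C y"
    and scaleC_add_left: "(a + b) *\<^sub>C x = a *\<^sub>C x + b *\<^sub>C x"
    and scaleC_scaleC: "a *\<^sub>C b *\<^sub>C x = (a * b) *\<^sub>C x"
    and cinner_commute: "cinner x y = cnj (cinner y x)"
    and cinner_add_left: "cinner (x + y) z = cinner x z + cinner y z"
    and cinner_scaleC_left: "cinner (a *\<^sub>C x) y = a * cinner x y"
    and cinner_self: "cinner x x = complex_of_real ((norm x)\<^sup>2)"

lemma vector_space_scaleC:
  "vector_space (scaleC :: complex \<Rightarrow> 'a \<Rightarrow> 'a::complex_hilbert_space)"
proof
  show "1 *\<^sub>C x = x" for x :: 'a
    using scaleR_scaleC[of 1 x] by simp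
qed (simp_all add: scaleC_add_right scaleC_add_left scaleC_scaleC)

text \<open>
  The library's \<^const>\<open>vector_space.dim\<close> is \<open>0\<close> on spaces without a finite basis, hence the case
  distinction.
\<close>

definition cdim :: "'a::complex_hilbert_space itself \<Rightarrow> enat" where
  "cdim _ = (if \<exists>B::'a set. finite B \<and> module.span scaleC B = UNIV
             then enat (vector_space.dim scaleC (UNIV :: 'a set)) else \<infinity>)"

lemma enat_le_cdim_iff:
  "enat n \<le> cdim TYPE('a::complex_hilbert_space) \<longleftrightarrow>
   (\<exists>B::'a set. finite B \<and> card B = n \<and> \<not> module.dependent scaleC B)"
proof -
  interpret V: vector_space "scaleC :: complex \<Rightarrow> 'a \<Rightarrow> 'a"
    by (rule vector_space_scaleC)
  obtain C :: "'a set" where C: "V.independent C" "UNIV \<subseteq> V.span C" "card C = V.dim UNIV"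
    using V.basis_exists[of UNIV] by blast
  show ?thesis
  proof (cases "\<exists>B::'a set. finite B \<and> V.span B = UNIV")
    case True
    then obtain B0 :: "'a set" where B0: "finite B0" "V.span B0 = UNIV" by blast
    have fin: "finite B \<and> card B \<le> V.dim UNIV" if "V.independent B" for B
    proof -
      have "finite B"
        using V.independent_span_bound[OF B0(1) that] B0(2) by auto
      moreover have "finite C"
        using V.independent_span_bound[OF B0(1) C(1)] B0(2) by auto
      then have "card B \<le> card C"
        using V.independent_span_bound[OF _ that, of C] C(2) by auto
      ultimately show ?thesis using C(3) by simp
    qed
    have "\<exists>B. finite B \<and> card B = n \<and> V.independent B" if le: "n \<le> V.dim UNIV"
    proof -
      obtain B where "B \<subseteq> C" "card B = n" "finite B"
        using le C(3) obtain_subset_with_card_n[of n C] by metis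
      moreover have "V.independent B" using V.independent_mono[OF C(1) \<open>B \<subseteq> C\<close>] .
      ultimately show ?thesis by blast
    qed
    then have "n \<le> V.dim UNIV \<longleftrightarrow> (\<exists>B. finite B \<and> card B = n \<and> V.independent B)"
      using fin by metis
    then show ?thesis using True by (simp add: cdim_def)
  next
    case False
    then have "infinite C" using C(2) by auto
    then obtain B where "B \<subseteq> C" "card B = n" "finite B"
      using infinite_arbitrarily_large by metis
    moreover have "V.independent B" using V.independent_mono[OF C(1) \<open>B \<subseteq> C\<close>] .
    ultimately have "\<exists>B. finite B \<and> card B = n \<and> V.independent B" by blast
    then show ?thesis unfolding cdim_def if_not_P[OF False] by simp
  qed
qed

definition bounded_clinear ::
    "('a::complex_hilbert_space \<Rightarrow> 'b::complex_hilbert_space) \<Rightarrow> bool" where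
  "bounded_clinear T \<longleftrightarrow> bounded_linear T \<and> (\<forall>c x. T (c *\<^sub>C x) = c *\<^sub>C T x)"


section \<open>Isometries from \<open>C^n\<close> and their adjoints\<close>

text \<open>
  \<open>C^n\<close> is \<^term>\<open>carrier_vec n\<close>.  Only the values of \<open>X\<close> on this carrier matter below.
\<close>

definition linear_isometry :: "nat \<Rightarrow> (complex vec \<Rightarrow> 'a::complex_hilbert_space) \<Rightarrow> bool" where
  "linear_isometry n X \<longleftrightarrow>
     (\<forall>v\<in>carrier_vec n. \<forall>w\<in>carrier_vec n. X (v + w) = X v + X w) \<and>
     (\<forall>c. \<forall>v\<in>carrier_vec n. X (c \<cdot>\<^sub>v v) = c *\<^sub>C X v) \<and>
     (\<forall>v\<in>carrier_vec n. norm (X v) = sqrt (Re (v \<bullet>c v)))"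

definition is_cadjoint ::
    "nat \<Rightarrow> (complex vec \<Rightarrow> 'a::complex_hilbert_space) \<Rightarrow> ('a \<Rightarrow> complex vec) \<Rightarrow> bool" where
  "is_cadjoint n X Y \<longleftrightarrow>
     (\<forall>h. Y h \<in> carrier_vec n) \<and> (\<forall>v\<in>carrier_vec n. \<forall>h. cinner (X v) h = v \<bullet>c Y h)"

definition cadjoint ::
    "nat \<Rightarrow> (complex vec \<Rightarrow> 'a::complex_hilbert_space) \<Rightarrow> 'a \<Rightarrow> complex vec" where
  "cadjoint n X = (THE Y. is_cadjoint n X Y)"

lemma is_cadjoint_unique:
  assumes "is_cadjoint n X Y" "is_cadjoint n X Z"
  shows "Y = Z"
proof
  fix h
  have c: "Y h \<in> carrier_vec n" "Z h \<in> carrier_vec n"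
    using assms by (auto simp: is_cadjoint_def)
  show "Y h = Z h"
  proof (rule eq_vecI)
    show "dim_vec (Y h) = dim_vec (Z h)" using c by auto
    fix i assume "i < dim_vec (Z h)"
    then have i: "i < n" using c by auto
    have "unit_vec n i \<bullet>c Y h = unit_vec n i \<bullet>c Z h"
      using assms by (auto simp: is_cadjoint_def dest!: bspec[of _ _ "unit_vec n i"])
    then show "Y h $ i = Z h $ i"
      using c i by (simp add: scalar_prod_left_unit)
  qed
qed

lemma is_cadjoint_cadjoint:
  fixes X :: "complex vec \<Rightarrow> 'a::complex_hilbert_space"
  assumes X: "linear_isometry n X"
  shows "is_cadjoint n X (cadjoint n X)"
proof -
  interpret V: vector_space "scaleC :: complex \<Rightarrow> 'a \<Rightarrow> 'a"
    by (rule vector_space_scaleC)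
  define Y where "Y h = vec n (\<lambda>i. cnj (cinner (X (unit_vec n i)) h))" for h
  define trunc where "trunc v k = vec n (\<lambda>i. if i < k then v $ i else 0)" for v :: "complex vec" and k
  have add: "X (v + w) = X v + X w" if "v \<in> carrier_vec n" "w \<in> carrier_vec n" for v w
    using X that by (auto simp: linear_isometry_def)
  have smult: "X (c \<cdot>\<^sub>v v) = c *\<^sub>C X v" if "v \<in> carrier_vec n" for c v
    using X that by (auto simp: linear_isometry_def)
  have partial_sum: "cinner (X (trunc v k)) h = (\<Sum>i<k. v $ i * cinner (X (unit_vec n i)) h)"
    if v: "v \<in> carrier_vec n" and "k \<le> n" for v k h
    using \<open>k \<le> n\<close>
  proof (induction k)
    case 0
    have "trunc v 0 = 0 \<cdot>\<^sub>v 0\<^sub>v n" by (auto simp: trunc_def)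
    then have "X (trunc v 0) = 0" using smult[of "0\<^sub>v n" 0] by simp
    then show ?case using cinner_scaleC_left[of 0 "0::'a" h] by simp
  next
    case (Suc k)
    have "trunc v (Suc k) = trunc v k + v $ k \<cdot>\<^sub>v unit_vec n k"
      using Suc.prems v by (intro eq_vecI) (auto simp: trunc_def less_Suc_eq)
    moreover have "trunc v k \<in> carrier_vec n" by (simp add: trunc_def)
    ultimately have "X (trunc v (Suc k)) = X (trunc v k) + v $ k *\<^sub>C X (unit_vec n k)"
      by (simp add: add smult)
    then show ?case using Suc by (simp add: cinner_add_left cinner_scaleC_left)
  qed
  have "cinner (X v) h = v \<bullet>c Y h" if v: "v \<in> carrier_vec n" for v h
  proof -
    have "trunc v n = v" using v by (intro eq_vecI) (auto simp: trunc_def)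
    then show ?thesis
      using partial_sum[OF v order_refl, of h]
      by (simp add: Y_def scalar_prod_def lessThan_atLeast0)
  qed
  moreover have "Y h \<in> carrier_vec n" for h by (simp add: Y_def)
  ultimately have "is_cadjoint n X Y" unfolding is_cadjoint_def by blast
  then show ?thesis
    unfolding cadjoint_def by (metis is_cadjoint_unique theI)
qed


section \<open>Joint matricial ranges\<close>

text \<open>
  \<open>C^p \<otimes> C^q\<close> is identified with \<open>C^(p*q)\<close> by sending \<open>e\<^sub>i \<otimes> e\<^sub>a\<close> to \<open>e\<^sub>k\<close>, \<open>k = i*q + a\<close>; the tensor
  product of matrices is then the Kronecker product.
\<close>

definition kronecker :: "complex mat \<Rightarrow> complex mat \<Rightarrow> complex mat" where
  "kronecker A B =
     mat (dim_row A * dim_row B) (dim_col A * dim_col B)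
       (\<lambda>(i, j). A $$ (i div dim_row B, j div dim_col B) * B $$ (i mod dim_row B, j mod dim_col B))"

text \<open>
  Operator tuples, elements of \<open>M_q^m\<close> and elements of \<open>C^m\<close> are lists of length \<open>m\<close>.
\<close>

definition matricial_range ::
    "nat \<Rightarrow> nat \<Rightarrow> ('a::complex_hilbert_space \<Rightarrow> 'a) list \<Rightarrow> complex mat list set" where
  "matricial_range p q As =
     {Bs. length Bs = length As \<and> set Bs \<subseteq> carrier_mat q q \<and>
       (\<exists>X. linear_isometry (p * q) X \<and>
         (\<forall>j<length As. \<forall>v\<in>carrier_vec (p * q).
            cadjoint (p * q) X ((As ! j) (X v)) = kronecker (1\<^sub>m p) (Bs ! j) *\<^sub>v v))}"

definition rank_range ::
    "nat \<Rightarrow> ('a::complex_hilbert_space \<Rightarrow> 'a) list \<Rightarrow> complex list set" where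
  "rank_range k As =
     {bs. length bs = length As \<and>
       (\<exists>X. linear_isometry k X \<and>
         (\<forall>j<length As. \<forall>v\<in>carrier_vec k.
            cadjoint k X ((As ! j) (X v)) = (bs ! j \<cdot>\<^sub>m 1\<^sub>m k) *\<^sub>v v))}"


section \<open>Star-shapedness in \<open>M_q^m\<close>\<close>

definition star_center :: "complex mat list set \<Rightarrow> complex mat list \<Rightarrow> bool" where
  "star_center S Cs \<longleftrightarrow> Cs \<in> S \<and>
     (\<forall>Bs\<in>S. \<forall>t::real. 0 \<le> t \<and> t \<le> 1 \<longrightarrow>
        map2 (\<lambda>C B. complex_of_real t \<cdot>\<^sub>m C + complex_of_real (1 - t) \<cdot>\<^sub>m B) Cs Bs \<in> S)"

definition star_shaped :: "complex mat list set \<Rightarrow> bool" where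
  "star_shaped S \<longleftrightarrow> (\<exists>Cs. star_center S Cs)"

end

theory Submission
  imports Defs "HOL-Analysis.Function_Topology" "Jordan_Normal_Form.Spectral_Radius"
begin

text \<open>
  \<^emph>\<open>Non-emptiness.\<close>  Choose \<open>N + 1\<close> orthonormal vectors, \<open>N = (k - 1)(2m + 1)\<close>, on whose span all the
  \<open>A\<^sub>j\<close> compress to diagonal operators: each new vector has to satisfy \<open>2m + 1\<close> linear conditions for
  every previous one.  By Tverberg's theorem in \<open>\<real>\<^bsup>2m\<^esup>\<close> the \<open>N + 1\<close> joint diagonal entries split into
  \<open>k\<close> groups whose convex hulls meet; the square roots of the barycentric weights combine each group
  into one vector of an orthonormal \<open>k\<close>-family on which every \<open>A\<^sub>j\<close> compresses to a scalar.

  \<^emph>\<open>Star-centers.\<close>  Given \<open>X\<close> realising \<open>B\<close>, the large range to which \<open>C\<close> belongs leaves room for a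
  realisation \<open>W\<close> of \<open>C\<close> whose range is orthogonal to the ranges of \<open>X\<close>, \<open>A\<^sub>j X\<close> and \<open>A\<^sub>j\<^sup>* X\<close>.  Then
  \<open>\<surd>t W + \<surd>(1 - t) X\<close> realises \<open>t C + (1 - t) B\<close>.
\<close>

section \<open>Tverberg's theorem\<close>

lemma homogeneous_system_nontrivial_solution:
  fixes a :: "'j \<Rightarrow> 'i \<Rightarrow> 'f::field"
  assumes "finite J" "finite I" "card J < card I"
  shows "\<exists>\<mu>. (\<exists>i\<in>I. \<mu> i \<noteq> 0) \<and> (\<forall>j\<in>J. (\<Sum>i\<in>I. \<mu> i * a j i) = 0)"
  using assms
proof (induction J arbitrary: I a rule: finite_induct)
  case empty
  then have "I \<noteq> {}" by auto
  then show ?case by (auto intro!: exI[of _ "\<lambda>_. 1"])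
next
  case (insert j J)
  show ?case
  proof (cases "\<forall>i\<in>I. a j i = 0")
    case True
    with insert.IH[of I a] insert.prems insert.hyps show ?thesis by auto
  next
    case False
    then obtain i0 where i0: "i0 \<in> I" "a j i0 \<noteq> 0" by blast
    let ?I = "I - {i0}"
    have "card J < card ?I" using insert.prems insert.hyps i0 by simp
    from insert.IH[OF _ this, of "\<lambda>j' i. a j' i - a j i * a j' i0 / a j i0"] insert.prems
    obtain \<mu> where \<mu>: "\<exists>i\<in>?I. \<mu> i \<noteq> 0"
      and eq: "\<And>j'. j' \<in> J \<Longrightarrow> (\<Sum>i\<in>?I. \<mu> i * (a j' i - a j i * a j' i0 / a j i0)) = 0"
      by auto
    define s where "s = (\<Sum>i\<in>?I. \<mu> i * a j i)"
    define \<nu> where "\<nu> = \<mu>(i0 := - s / a j i0)"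
    have \<nu>: "(\<Sum>i\<in>I. \<nu> i * a j' i) = (\<Sum>i\<in>?I. \<mu> i * a j' i) - s / a j i0 * a j' i0" for j'
      by (subst sum.remove[OF insert.prems(1) i0(1)])
         (auto simp: \<nu>_def intro!: sum.cong)
    have "(\<Sum>i\<in>I. \<nu> i * a j' i) = 0" if "j' \<in> insert j J" for j'
    proof (cases "j' = j")
      case True
      then show ?thesis using i0 by (simp add: \<nu> s_def)
    next
      case False
      with that have "(\<Sum>i\<in>?I. \<mu> i * (a j' i - a j i * a j' i0 / a j i0)) = 0"
        using eq by simp
      then show ?thesis
        by (simp add: \<nu> s_def right_diff_distrib sum_subtractf sum_distrib_right sum_divide_distrib
            mult.assoc)
    qed
    moreover have "\<exists>i\<in>I. \<nu> i \<noteq> 0" using \<mu> by (auto simp: \<nu>_def)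
    ultimately show ?thesis by blast
  qed
qed

lemma compact_simplex:
  "compact {\<theta> :: 'i \<Rightarrow> real. (\<forall>i. \<theta> i \<in> {0..1}) \<and> (\<Sum>i\<in>I. \<theta> i) = 1}"
proof -
  have "compact (PiE UNIV (\<lambda>_::'i. {0..1::real}))"
    using compactin_PiE[of "\<lambda>_::'i. euclidean :: real topology" UNIV "\<lambda>_. {0..1}"]
    by (simp add: euclidean_product_topology)
  moreover have "closed {\<theta> :: 'i \<Rightarrow> real. (\<Sum>i\<in>I. \<theta> i) = 1}"
    by (intro closed_Collect_eq continuous_intros continuous_on_product_coordinates)
  ultimately have "compact (PiE UNIV (\<lambda>_::'i. {0..1::real}) \<inter> {\<theta>. (\<Sum>i\<in>I. \<theta> i) = 1})"
    by (rule compact_Int_closed)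
  then show ?thesis by (simp add: PiE_UNIV_domain Pi_def Collect_conj_eq)
qed

lemma simplex_attains_min:
  fixes F :: "('i \<Rightarrow> real) \<Rightarrow> real"
  assumes "finite I" "I \<noteq> {}" "continuous_on UNIV F"
    and cong: "\<And>\<theta> \<theta>'. (\<And>i. i \<in> I \<Longrightarrow> \<theta> i = \<theta>' i) \<Longrightarrow> F \<theta> = F \<theta>'"
  shows "\<exists>\<theta>. (\<forall>i\<in>I. 0 \<le> \<theta> i) \<and> sum \<theta> I = 1 \<and>
    (\<forall>\<theta>'. (\<forall>i\<in>I. 0 \<le> \<theta>' i) \<longrightarrow> sum \<theta>' I = 1 \<longrightarrow> F \<theta> \<le> F \<theta>')"
proof -
  let ?S = "{\<theta> :: 'i \<Rightarrow> real. (\<forall>i. \<theta> i \<in> {0..1}) \<and> (\<Sum>i\<in>I. \<theta> i) = 1}"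
  obtain i0 where i0: "i0 \<in> I" using assms by blast
  have "(\<lambda>i. if i = i0 then 1 else 0) \<in> ?S" using i0 assms(1) by simp
  then have "?S \<noteq> {}" by (metis empty_iff)
  from continuous_attains_inf[OF compact_simplex this, of F] assms(3) continuous_on_subset
  obtain \<theta> where \<theta>: "\<theta> \<in> ?S" and min: "\<And>\<theta>'. \<theta>' \<in> ?S \<Longrightarrow> F \<theta> \<le> F \<theta>'" by blast
  have "F \<theta> \<le> F \<theta>'" if \<theta>': "\<forall>i\<in>I. 0 \<le> \<theta>' i" "sum \<theta>' I = 1" for \<theta>'
  proof -
    let ?r = "\<lambda>i. if i \<in> I then \<theta>' i else 0"
    have "\<theta>' i \<le> 1" if "i \<in> I" for i
      using member_le_sum[of i I \<theta>'] \<theta>' that assms(1) by auto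
    then have "?r \<in> ?S" using \<theta>' by simp
    then have "F \<theta> \<le> F ?r" by (rule min)
    also have "F ?r = F \<theta>'" by (rule cong) simp
    finally show ?thesis .
  qed
  then show ?thesis using \<theta> by auto
qed

lemma nearest_point_first_order:
  fixes z v :: "'e \<Rightarrow> real"
  assumes "\<And>t. 0 \<le> t \<Longrightarrow> t \<le> 1 \<Longrightarrow> (\<Sum>e\<in>E. (z e)\<^sup>2) \<le> (\<Sum>e\<in>E. ((1 - t) * z e + t * v e)\<^sup>2)"
  shows "(\<Sum>e\<in>E. (z e)\<^sup>2) \<le> (\<Sum>e\<in>E. z e * v e)"
proof (rule ccontr)
  define Z D where "Z = (\<Sum>e\<in>E. (z e)\<^sup>2)" and "D = (\<Sum>e\<in>E. z e * v e)"
  define Q where "Q = (\<Sum>e\<in>E. (v e - z e)\<^sup>2)"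
  assume "\<not> ?thesis"
  then have d: "Z - D > 0" by (simp add: Z_def D_def)
  have Q0: "Q \<ge> 0" by (simp add: Q_def sum_nonneg)
  have expand: "(\<Sum>e\<in>E. ((1 - t) * z e + t * v e)\<^sup>2) = Z - 2 * t * (Z - D) + t\<^sup>2 * Q" for t
    unfolding Z_def D_def Q_def sum_distrib_left sum_subtractf[symmetric] sum.distrib[symmetric]
    by (rule sum.cong) (auto simp: power2_eq_square algebra_simps)
  define t where "t = min 1 ((Z - D) / (Q + 1))"
  have t: "0 < t" "t \<le> 1" "t * (Q + 1) \<le> Z - D"
    using d Q0 by (simp_all add: t_def flip: pos_le_divide_eq)
  have "t * (t * Q) \<le> t * (Z - D)" using t by (intro mult_left_mono) (auto simp: algebra_simps)
  moreover have "0 < t * (Z - D)" using t d by simp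
  ultimately have "Z - 2 * t * (Z - D) + t\<^sup>2 * Q < Z"
    by (simp add: power2_eq_square mult.assoc)
  with assms[of t] t expand[of t] show False by (simp add: Z_def)
qed

theorem colourful_caratheodory:
  fixes V :: "'i \<Rightarrow> 'j \<Rightarrow> 'e \<Rightarrow> real"
  assumes I: "finite I" and J: "finite J" and E: "finite E" and card: "card E < card I"
    and zero: "\<And>i. i \<in> I \<Longrightarrow> \<exists>w. (\<forall>j\<in>J. 0 \<le> w j) \<and> sum w J = (1::real) \<and>
      (\<forall>e\<in>E. (\<Sum>j\<in>J. w j * V i j e) = 0)"
  shows "\<exists>f \<theta>. f \<in> I \<rightarrow> J \<and> (\<forall>i\<in>I. 0 \<le> \<theta> i) \<and> sum \<theta> I = 1 \<and>
    (\<forall>e\<in>E. (\<Sum>i\<in>I. \<theta> i * V i (f i) e) = 0)"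
proof -
  define z where "z f \<theta> e = (\<Sum>i\<in>I. \<theta> i * V i (f i) e)" for f \<theta> e
  define F where "F f \<theta> = (\<Sum>e\<in>E. (z f \<theta> e)\<^sup>2)" for f \<theta>
  define simplex where "simplex \<theta> \<longleftrightarrow> (\<forall>i\<in>I. 0 \<le> \<theta> i) \<and> sum \<theta> I = 1" for \<theta> :: "'i \<Rightarrow> real"
  have I0: "I \<noteq> {}" using card by auto
  have "J \<noteq> {}" using I0 zero by force
  have "\<exists>\<theta>. simplex \<theta> \<and> (\<forall>\<theta>'. simplex \<theta>' \<longrightarrow> F f \<theta> \<le> F f \<theta>')" for f
  proof -
    have "continuous_on UNIV (F f)" unfolding F_def z_def
      by (intro continuous_intros continuous_on_product_coordinates)
    from simplex_attains_min[OF I I0 this] show ?thesis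
      unfolding simplex_def by (simp add: F_def z_def imp_conjL)
  qed
  then obtain L where L: "\<And>f. simplex (L f)" "\<And>f \<theta>'. simplex \<theta>' \<Longrightarrow> F f (L f) \<le> F f \<theta>'"
    by metis
  have "finite (PiE I (\<lambda>_. J))" "PiE I (\<lambda>_. J) \<noteq> {}"
    using I J \<open>J \<noteq> {}\<close> by (auto intro: finite_PiE simp: PiE_eq_empty_iff)
  from arg_min_if_finite[OF this, of "\<lambda>f. F f (L f)"]
  obtain f where f: "f \<in> PiE I (\<lambda>_. J)"
    and fmin: "\<And>g. g \<in> PiE I (\<lambda>_. J) \<Longrightarrow> F f (L f) \<le> F g (L g)"
    by (metis (no_types, lifting) linorder_not_less)
  define m where "m = F f (L f)"
  have min: "m \<le> F g \<theta>" if "g \<in> PiE I (\<lambda>_. J)" "simplex \<theta>" for g \<theta>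
    using fmin[OF that(1)] L(2)[OF that(2), of g] by (simp add: m_def)
  have first_order: "m \<le> (\<Sum>e\<in>E. z g \<theta> e * V i (g i) e)"
    if g: "g \<in> PiE I (\<lambda>_. J)" and \<theta>: "simplex \<theta>" "F g \<theta> = m" and i: "i \<in> I" for g \<theta> i
  proof -
    have "(\<Sum>e\<in>E. (z g \<theta> e)\<^sup>2) \<le> (\<Sum>e\<in>E. ((1 - t) * z g \<theta> e + t * V i (g i) e)\<^sup>2)"
      if t: "0 \<le> t" "t \<le> 1" for t
    proof -
      define \<theta>' where "\<theta>' = (\<lambda>l. (1 - t) * \<theta> l + (if l = i then t else 0))"
      have "simplex \<theta>'"
        using \<theta>(1) t i I by (auto simp: simplex_def \<theta>'_def sum.distrib sum_distrib_left[symmetric])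
      moreover have "z g \<theta>' e = (1 - t) * z g \<theta> e + t * V i (g i) e" for e
        using i I by (simp add: z_def \<theta>'_def distrib_right sum.distrib sum_distrib_left mult.assoc
            if_distrib[of "\<lambda>x. x * _"] cong: if_cong)
      ultimately show ?thesis using min[OF g, of \<theta>'] \<theta>(2) by (simp add: F_def)
    qed
    from nearest_point_first_order[OF this] show ?thesis using \<theta>(2) by (simp add: F_def)
  qed
  have "m = 0"
  proof (rule ccontr)
    assume "m \<noteq> 0"
    then have m: "m > 0" by (simp add: m_def F_def less_le sum_nonneg)
    \<comment> \<open>With full support, all the chosen vectors lie on a hyperplane off the origin, so a linear
      dependency is an affine one and allows emptying some coefficient.\<close>
    have "\<exists>\<theta> i0. simplex \<theta> \<and> F f \<theta> = m \<and> i0 \<in> I \<and> \<theta> i0 = 0"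
    proof (cases "\<exists>i\<in>I. L f i = 0")
      case True
      then show ?thesis using L(1)[of f] by (auto simp: m_def)
    next
      case False
      define \<theta> where "\<theta> = L f"
      have simp_\<theta>: "simplex \<theta>" and F\<theta>: "F f \<theta> = m" using L by (auto simp: \<theta>_def m_def)
      have pos: "\<theta> i > 0" if "i \<in> I" for i
        using False simp_\<theta> that by (auto simp: \<theta>_def simplex_def less_le)
      define d where "d i = (\<Sum>e\<in>E. z f \<theta> e * V i (f i) e)" for i
      have d_ge: "m \<le> d i" if "i \<in> I" for i
        using first_order[OF f simp_\<theta> F\<theta> that] by (simp add: d_def)
      have swap: "(\<Sum>i\<in>I. \<mu> i * d i) = (\<Sum>e\<in>E. z f \<theta> e * z f \<mu> e)" for \<mu>
        unfolding d_def z_def[of f \<mu>] sum_distrib_left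
        by (subst sum.swap) (auto intro!: sum.cong)
      have "(\<Sum>i\<in>I. \<theta> i * (d i - m)) = 0"
        using swap[of \<theta>] F\<theta> simp_\<theta>
        by (simp add: right_diff_distrib sum_subtractf sum_distrib_right[symmetric] F_def simplex_def
            power2_eq_square)
      then have "\<forall>i\<in>I. \<theta> i * (d i - m) = 0"
        using d_ge pos by (subst (asm) sum_nonneg_eq_0_iff) (simp_all add: I less_imp_le)
      then have d_eq: "d i = m" if "i \<in> I" for i using pos that by force
      from homogeneous_system_nontrivial_solution[OF E I card, of "\<lambda>e i. V i (f i) e"]
      obtain \<mu> where \<mu>: "\<exists>i\<in>I. \<mu> i \<noteq> 0" "\<And>e. e \<in> E \<Longrightarrow> z f \<mu> e = 0"
        unfolding z_def by blast
      have "m * sum \<mu> I = 0"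
        using swap[of \<mu>] \<mu>(2) d_eq by (simp add: sum_distrib_left mult.commute)
      then have sum\<mu>: "sum \<mu> I = 0" using m by simp
      define N where "N = {i\<in>I. \<mu> i < 0}"
      have "N \<noteq> {}"
      proof
        assume "N = {}"
        then have "\<forall>i\<in>I. 0 \<le> \<mu> i" by (auto simp: N_def not_less)
        with sum\<mu> \<mu>(1) I show False by (simp add: sum_nonneg_eq_0_iff)
      qed
      moreover have "finite N" using I by (simp add: N_def)
      ultimately obtain i0 where i0: "i0 \<in> N"
        and i0min: "\<And>i. i \<in> N \<Longrightarrow> \<theta> i0 / - \<mu> i0 \<le> \<theta> i / - \<mu> i"
        using arg_min_if_finite[of N "\<lambda>i. \<theta> i / - \<mu> i"] by (metis (no_types, lifting) linorder_not_less)
      define t where "t = \<theta> i0 / - \<mu> i0"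
      have t0: "t \<ge> 0" using i0 pos[of i0] unfolding t_def N_def
        by (auto intro!: divide_nonneg_nonneg simp: divide_nonneg_neg less_imp_le)
      define \<theta>' where "\<theta>' i = \<theta> i + t * \<mu> i" for i
      have "0 \<le> \<theta>' i" if "i \<in> I" for i
      proof (cases "i \<in> N")
        case True
        then have "t * - \<mu> i \<le> \<theta> i"
          using i0min[OF True] by (simp add: t_def N_def field_simps)
        then show ?thesis by (simp add: \<theta>'_def)
      next
        case False
        then show ?thesis using t0 pos[OF that] that by (auto simp: \<theta>'_def N_def)
      qed
      moreover have "sum \<theta>' I = 1"
        using simp_\<theta> sum\<mu> by (simp add: \<theta>'_def sum.distrib sum_distrib_left[symmetric] simplex_def)
      ultimately have "simplex \<theta>'" by (simp add: simplex_def)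
      moreover have "z f \<theta>' e = z f \<theta> e" if "e \<in> E" for e
        using \<mu>(2)[OF that]
        by (simp add: \<theta>'_def z_def distrib_right sum.distrib mult.assoc sum_distrib_left[symmetric])
      then have "F f \<theta>' = m" using F\<theta> by (simp add: F_def)
      moreover have "\<theta>' i0 = 0" using i0 by (simp add: \<theta>'_def t_def N_def)
      ultimately show ?thesis using i0 by (auto simp: N_def)
    qed
    then obtain \<theta> i0 where \<theta>: "simplex \<theta>" "F f \<theta> = m" and i0: "i0 \<in> I" "\<theta> i0 = 0" by blast
    obtain w where w: "\<And>j. j \<in> J \<Longrightarrow> 0 \<le> w j" "sum w J = (1::real)"
      "\<And>e. e \<in> E \<Longrightarrow> (\<Sum>j\<in>J. w j * V i0 j e) = 0"
      using zero[OF i0(1)] by blast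
    define d where "d j = (\<Sum>e\<in>E. z f \<theta> e * V i0 j e)" for j
    have "m \<le> d j" if j: "j \<in> J" for j
    proof -
      define g where "g = f(i0 := j)"
      have g: "g \<in> PiE I (\<lambda>_. J)" using f i0 j by (auto simp: g_def PiE_iff extensional_def)
      have zg: "z g \<theta> = z f \<theta>"
        by (auto simp: z_def g_def i0 fun_eq_iff intro!: sum.cong)
      then have "F g \<theta> = m" using \<theta>(2) by (simp add: F_def)
      from first_order[OF g \<theta>(1) this i0(1)] show ?thesis
        by (simp add: zg d_def) (simp add: g_def)
    qed
    then have "(\<Sum>j\<in>J. w j * m) \<le> (\<Sum>j\<in>J. w j * d j)"
      using w(1) by (intro sum_mono mult_left_mono) auto
    also have "\<dots> = (\<Sum>e\<in>E. z f \<theta> e * (\<Sum>j\<in>J. w j * V i0 j e))"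
      unfolding d_def sum_distrib_left
      by (subst sum.swap) (auto intro!: sum.cong)
    also have "\<dots> = 0" using w(3) by simp
    finally show False using w(2) m by (simp add: sum_distrib_right[symmetric])
  qed
  then have "\<forall>e\<in>E. z f (L f) e = 0"
    using E by (simp add: m_def F_def sum_nonneg_eq_0_iff)
  moreover have "f \<in> I \<rightarrow> J" using f by auto
  ultimately show ?thesis using L(1)[of f] unfolding simplex_def z_def by blast
qed

text \<open>
  Sarkaria's reduction: in the space of families of \<open>k - 1\<close> vectors of dimension \<open>d + 1\<close>, the
  tensors of \<open>(y\<^sub>i, 1)\<close> with the vertices \<open>e\<^sub>0, \<dots>, e\<^bsub>k-2\<^esub>, -\<Sum>e\<^sub>j\<close> of a simplex around the
  origin form colour class \<open>i\<close>.  The coordinate \<open>c = d\<close> carries the constant \<open>1\<close>.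
\<close>

theorem tverberg:
  fixes y :: "nat \<Rightarrow> nat \<Rightarrow> real" and k d :: nat
  assumes "k \<ge> 1"
  defines "N \<equiv> (k - 1) * (d + 1) + 1"
  shows "\<exists>f \<theta> b. f \<in> {..<N} \<rightarrow> {..<k} \<and> (\<forall>i<N. 0 \<le> \<theta> i) \<and>
    (\<forall>j<k. (\<Sum>i | i < N \<and> f i = j. \<theta> i) = 1 \<and>
      (\<forall>c<d. (\<Sum>i | i < N \<and> f i = j. \<theta> i * y i c) = b c))"
proof -
  define v where "v i c = (if c = d then 1 else y i c)" for i c
  define w :: "nat \<Rightarrow> nat \<Rightarrow> real" where
    "w j j' = (if j = k - 1 then - 1 else if j = j' then 1 else 0)" for j j'
  define V where "V i j = (\<lambda>(j', c). v i c * w j j')" for i j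
  have ksplit: "{..<k} = insert (k - 1) {..<k - 1}" using assms(1) by auto
  have w0: "(\<Sum>j<k. w j j') = 0" if "j' < k - 1" for j'
    unfolding ksplit using that by (simp add: w_def)
  have "\<exists>f \<theta>. f \<in> {..<N} \<rightarrow> {..<k} \<and> (\<forall>i\<in>{..<N}. 0 \<le> \<theta> i) \<and> sum \<theta> {..<N} = 1 \<and>
    (\<forall>e\<in>{..<k - 1} \<times> {..d}. (\<Sum>i<N. \<theta> i * V i (f i) e) = 0)"
  proof (rule colourful_caratheodory)
    show "card ({..<k - 1} \<times> {..d}) < card {..<N}" by (simp add: N_def)
    show "\<exists>u. (\<forall>j\<in>{..<k}. 0 \<le> u j) \<and> sum u {..<k} = (1::real) \<and>
        (\<forall>e\<in>{..<k - 1} \<times> {..d}. (\<Sum>j<k. u j * V i j e) = 0)" for i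
      using assms(1) w0
      by (auto intro!: exI[of _ "\<lambda>_. 1 / real k"]
          simp: V_def sum_divide_distrib[symmetric] sum_distrib_left[symmetric])
  qed auto
  then obtain f \<theta> where f: "f \<in> {..<N} \<rightarrow> {..<k}" and \<theta>: "\<And>i. i < N \<Longrightarrow> 0 \<le> \<theta> i"
    and sum1: "sum \<theta> {..<N} = 1"
    and V0: "\<forall>e\<in>{..<k - 1} \<times> {..d}. (\<Sum>i<N. \<theta> i * V i (f i) e) = 0"
    by auto
  have eq: "(\<Sum>i<N. \<theta> i * (v i c * w (f i) j)) = 0" if "j < k - 1" "c \<le> d" for j c
    using V0[rule_format, of "(j, c)"] that by (simp add: V_def)
  define u where "u j c = (\<Sum>i | i < N \<and> f i = j. \<theta> i * v i c)" for j c
  have u_eq: "u j c = u (k - 1) c" if j: "j < k" and c: "c \<le> d" for j c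
  proof (cases "j = k - 1")
    case False
    then have j': "j < k - 1" using j by simp
    have "\<theta> i * (v i c * w (f i) j) =
        (if f i = j then \<theta> i * v i c else 0) - (if f i = k - 1 then \<theta> i * v i c else 0)" for i
      using j' by (auto simp: w_def)
    then have "(\<Sum>i<N. if f i = j then \<theta> i * v i c else 0)
        - (\<Sum>i<N. if f i = k - 1 then \<theta> i * v i c else 0) = 0"
      using eq[OF j' c] by (simp add: sum_subtractf)
    moreover have "(\<Sum>i<N. if f i = j' then \<theta> i * v i c else 0) = u j' c" for j'
      unfolding u_def by (simp add: sum.If_cases) (auto intro!: sum.cong)
    ultimately show ?thesis by simp
  qed simp
  have "(\<Sum>j<k. u j d) = (\<Sum>j<k. \<Sum>i | i \<in> {..<N} \<and> f i = j. \<theta> i)"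
    by (simp add: u_def v_def)
  also have "\<dots> = 1" using sum.group[of "{..<N}" "{..<k}" f \<theta>] f sum1 by auto
  finally have "(\<Sum>j<k. u j d) = 1" .
  moreover have "(\<Sum>j<k. u j d) = (\<Sum>j<k. u (k - 1) d)" by (intro sum.cong refl u_eq) auto
  ultimately have "real k * u (k - 1) d = 1" by simp
  then have uk: "real k * u j d = 1" if "j < k" for j using u_eq[OF that, of d] by simp
  show ?thesis
  proof (rule exI[of _ f], rule exI[of _ "\<lambda>i. real k * \<theta> i"],
      rule exI[of _ "\<lambda>c. real k * u (k - 1) c"], intro conjI allI impI)
    show "(\<Sum>i | i < N \<and> f i = j. real k * \<theta> i) = 1" if "j < k" for j
      using uk[OF that] by (simp add: u_def v_def sum_distrib_left)
    show "(\<Sum>i | i < N \<and> f i = j. real k * \<theta> i * y i c) = real k * u (k - 1) c"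
      if "j < k" "c < d" for j c
    proof -
      have "(\<Sum>i | i < N \<and> f i = j. \<theta> i * y i c) = u (k - 1) c"
        using u_eq[OF that(1), of c] that(2) by (simp add: u_def v_def)
      then show ?thesis by (simp add: sum_distrib_left mult.assoc flip: sum_distrib_left)
    qed
  qed (use f \<theta> in auto)
qed


section \<open>Orthonormal families and joint diagonalization\<close>

interpretation cvs: vector_space "scaleC :: complex \<Rightarrow> 'a \<Rightarrow> 'a::complex_hilbert_space"
  by (rule vector_space_scaleC)

lemma cinner_zero_left [simp]: "cinner 0 y = 0"
  using cinner_scaleC_left[of 0 0 y] by simp

lemma cinner_zero_right [simp]: "cinner y 0 = 0"
  using cinner_commute[of y 0] by simp

lemma cinner_add_right: "cinner x (y + z) = cinner x y + cinner x z"
  by (metis cinner_add_left cinner_commute complex_cnj_add)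

lemma cinner_scaleC_right: "cinner x (a *\<^sub>C y) = cnj a * cinner x y"
  by (metis cinner_commute cinner_scaleC_left complex_cnj_mult)

lemma cinner_eq_0_commute: "cinner x y = 0 \<longleftrightarrow> cinner y x = 0"
  by (metis cinner_commute complex_cnj_zero)

lemma cinner_sum_scaleC_left:
  "cinner (\<Sum>i\<in>I. s i *\<^sub>C x i) y = (\<Sum>i\<in>I. s i * cinner (x i) y)"
  by (induction I rule: infinite_finite_induct) (simp_all add: cinner_add_left cinner_scaleC_left)

lemma cinner_sum_scaleC_right:
  "cinner y (\<Sum>i\<in>I. s i *\<^sub>C x i) = (\<Sum>i\<in>I. cnj (s i) * cinner y (x i))"
  by (induction I rule: infinite_finite_induct) (simp_all add: cinner_add_right cinner_scaleC_right)

lemma bounded_clinear_id: "bounded_clinear id"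
  by (simp add: bounded_clinear_def bounded_linear_ident id_def)

lemma bounded_clinear_add: "bounded_clinear T \<Longrightarrow> T (x + y) = T x + T y"
  by (simp add: bounded_clinear_def bounded_linear.linear linear_add)

lemma bounded_clinear_scaleC: "bounded_clinear T \<Longrightarrow> T (c *\<^sub>C x) = c *\<^sub>C T x"
  by (simp add: bounded_clinear_def)

lemma bounded_clinear_sum_scaleC:
  assumes "bounded_clinear T"
  shows "T (\<Sum>i\<in>I. s i *\<^sub>C x i) = (\<Sum>i\<in>I. s i *\<^sub>C T (x i))"
proof -
  have "linear T" using assms by (simp add: bounded_clinear_def bounded_linear.linear)
  then show ?thesis using assms by (simp add: linear_sum bounded_clinear_scaleC)
qed

lemma cinner_bounded_clinear_combination:
  assumes "bounded_clinear T"
  shows "cinner (T (\<Sum>l\<in>I. s l *\<^sub>C x l)) (\<Sum>k\<in>I'. t k *\<^sub>C y k) =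
    (\<Sum>l\<in>I. \<Sum>k\<in>I'. s l * cnj (t k) * cinner (T (x l)) (y k))"
  unfolding bounded_clinear_sum_scaleC[OF assms] cinner_sum_scaleC_left
  by (simp add: cinner_sum_scaleC_right sum_distrib_left mult.assoc)

definition orthonormal_on :: "'i set \<Rightarrow> ('i \<Rightarrow> 'a::complex_hilbert_space) \<Rightarrow> bool" where
  "orthonormal_on I x \<longleftrightarrow> (\<forall>i\<in>I. \<forall>j\<in>I. cinner (x i) (x j) = of_bool (i = j))"

lemma cinner_orthonormal_combination:
  assumes "orthonormal_on I x" "finite I"
  shows "cinner (\<Sum>l\<in>I. s l *\<^sub>C x l) (\<Sum>l\<in>I. t l *\<^sub>C x l) = (\<Sum>l\<in>I. s l * cnj (t l))"
proof -
  have "cinner (\<Sum>l\<in>I. s l *\<^sub>C x l) (\<Sum>l\<in>I. t l *\<^sub>C x l) =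
      (\<Sum>l\<in>I. \<Sum>k\<in>I. s l * cnj (t k) * of_bool (l = k))"
    using assms(1) by (auto simp: cinner_sum_scaleC_left cinner_sum_scaleC_right sum_distrib_left
        orthonormal_on_def mult.assoc intro!: sum.cong)
  then show ?thesis using assms(2) by (simp add: of_bool_def if_distrib cong: if_cong)
qed

lemma orthonormal_on_extend:
  assumes "orthonormal_on {..<r} x" "cinner w w = 1" "\<And>i. i < r \<Longrightarrow> cinner w (x i) = 0"
  shows "orthonormal_on {..<Suc r} (x(r := w))"
  using assms by (auto simp: orthonormal_on_def less_Suc_eq cinner_eq_0_commute[of _ w])

lemma exists_unit_multiple:
  fixes v :: "'i \<Rightarrow> complex"
  assumes "finite I" "\<exists>l\<in>I. v l \<noteq> 0"
  shows "\<exists>c. (\<Sum>l\<in>I. (c * v l) * cnj (c * v l)) = 1"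
proof -
  define S where "S = (\<Sum>l\<in>I. (cmod (v l))\<^sup>2)"
  have "S > 0"
    using assms unfolding S_def by (auto intro!: sum_pos2)
  define c where "c = complex_of_real (1 / sqrt S)"
  have "(\<Sum>l\<in>I. (c * v l) * cnj (c * v l)) = complex_of_real (\<Sum>l\<in>I. (cmod (c * v l))\<^sup>2)"
    by (simp only: of_real_sum complex_norm_square)
  also have "(\<Sum>l\<in>I. (cmod (c * v l))\<^sup>2) = (1 / sqrt S)\<^sup>2 * S"
    unfolding S_def sum_distrib_left using \<open>S > 0\<close>
    by (intro sum.cong) (simp_all add: c_def norm_mult norm_divide power_divide S_def[symmetric])
  also have "\<dots> = 1" using \<open>S > 0\<close> by (simp add: power_divide)
  finally show ?thesis by auto
qed

lemma orthonormal_solutions: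
  fixes a :: "'j \<Rightarrow> 'i \<Rightarrow> complex"
  assumes "finite J" "finite I" "card J + p \<le> card I"
  shows "\<exists>s :: nat \<Rightarrow> 'i \<Rightarrow> complex.
    (\<forall>i<p. \<forall>i'<p. (\<Sum>l\<in>I. s i l * cnj (s i' l)) = of_bool (i = i')) \<and>
    (\<forall>i<p. \<forall>j\<in>J. (\<Sum>l\<in>I. s i l * a j l) = 0)"
  using assms(3)
proof (induction p)
  case 0
  then show ?case by simp
next
  case (Suc p)
  then have "card J + p \<le> card I" by simp
  from Suc.IH[OF this] obtain s where
    orth: "\<forall>i<p. \<forall>i'<p. (\<Sum>l\<in>I. s i l * cnj (s i' l)) = of_bool (i = i')"
    and ker: "\<forall>i<p. \<forall>j\<in>J. (\<Sum>l\<in>I. s i l * a j l) = 0"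
    by blast
  define b where "b = case_sum a (\<lambda>i l. cnj (s i l))"
  have "finite (J <+> {..<p})" "card (J <+> {..<p}) < card I"
    using assms(1) Suc.prems by (auto simp: card_Plus)
  from homogeneous_system_nontrivial_solution[OF this(1) assms(2) this(2), of b]
  obtain \<mu> where \<mu>: "\<exists>l\<in>I. \<mu> l \<noteq> 0" "\<forall>j\<in>J <+> {..<p}. (\<Sum>l\<in>I. \<mu> l * b j l) = 0"
    by blast
  obtain c where c: "(\<Sum>l\<in>I. (c * \<mu> l) * cnj (c * \<mu> l)) = 1"
    using exists_unit_multiple[OF assms(2) \<mu>(1)] by blast
  define w where "w l = c * \<mu> l" for l
  have wb: "(\<Sum>l\<in>I. w l * b j l) = 0" if "j \<in> J <+> {..<p}" for j
    using \<mu>(2) that by (simp add: w_def mult.assoc flip: sum_distrib_left)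
  have wJ: "(\<Sum>l\<in>I. w l * a j l) = 0" if "j \<in> J" for j
    using wb[OF InlI[OF that]] by (simp add: b_def)
  have ws: "(\<Sum>l\<in>I. w l * cnj (s i l)) = 0" if "i < p" for i
    using wb[OF InrI, of i] that by (simp add: b_def)
  have sw: "(\<Sum>l\<in>I. s i l * cnj (w l)) = 0" if "i < p" for i
    using arg_cong[OF ws[OF that], of cnj] by (simp add: mult.commute)
  show ?case
  proof (intro exI[of _ "s(p := w)"] conjI allI impI ballI)
    show "(\<Sum>l\<in>I. (s(p := w)) i l * cnj ((s(p := w)) i' l)) = of_bool (i = i')"
      if "i < Suc p" "i' < Suc p" for i i'
      using that orth ws sw c by (auto simp: less_Suc_eq w_def[symmetric])
    show "(\<Sum>l\<in>I. (s(p := w)) i l * a j l) = 0" if "i < Suc p" "j \<in> J" for i j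
      using that ker wJ by (auto simp: less_Suc_eq)
  qed
qed

lemma exists_orthonormal_family:
  fixes B :: "'a::complex_hilbert_space set"
  assumes B: "finite B" "card B = n" "\<not> module.dependent scaleC B"
  shows "\<exists>e :: nat \<Rightarrow> 'a. orthonormal_on {..<n} e"
proof -
  have "\<exists>e :: nat \<Rightarrow> 'a. orthonormal_on {..<r} e" if "r \<le> n" for r
    using that
  proof (induction r)
    case 0
    then show ?case by (simp add: orthonormal_on_def)
  next
    case (Suc r)
    then obtain e :: "nat \<Rightarrow> 'a" where e: "orthonormal_on {..<r} e" by auto
    obtain \<mu> where \<mu>: "\<exists>b\<in>B. \<mu> b \<noteq> 0" "\<And>i. i < r \<Longrightarrow> (\<Sum>b\<in>B. \<mu> b * cinner b (e i)) = 0"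
      using homogeneous_system_nontrivial_solution[of "{..<r}" B "\<lambda>i b. cinner b (e i)"] B(1,2) Suc.prems
      by auto
    define w where "w = (\<Sum>b\<in>B. \<mu> b *\<^sub>C b)"
    have "w \<noteq> 0" using \<mu>(1) B(1,3) cvs.dependent_finite[OF B(1)] by (auto simp: w_def)
    define u where "u = complex_of_real (1 / norm w) *\<^sub>C w"
    have "cinner u u = complex_of_real (1 / norm w) * (complex_of_real (1 / norm w) * cinner w w)"
      by (simp add: u_def cinner_scaleC_left cinner_scaleC_right)
    then have "cinner u u = 1" using \<open>w \<noteq> 0\<close> by (simp add: cinner_self power2_eq_square)
    moreover have "cinner u (e i) = 0" if "i < r" for i
      using \<mu>(2)[OF that] cinner_sum_scaleC_left[of \<mu> "\<lambda>b. b" B "e i"]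
      by (simp add: u_def w_def cinner_scaleC_left)
    ultimately show ?case using orthonormal_on_extend[OF e] by blast
  qed
  then show ?thesis by blast
qed

lemma exists_unit_eigenvector:
  fixes a :: "nat \<Rightarrow> nat \<Rightarrow> complex"
  assumes "n > 0"
  shows "\<exists>v \<mu>. (\<Sum>l<n. v l * cnj (v l)) = 1 \<and> (\<forall>i<n. (\<Sum>l<n. v l * a i l) = \<mu> * v i)"
proof -
  define A where "A = mat n n (\<lambda>(i, l). a i l)"
  have A: "A \<in> carrier_mat n n" by (simp add: A_def)
  from spectrum_non_empty[OF this assms] obtain \<mu> v where v: "v \<in> carrier_vec n" "v \<noteq> 0\<^sub>v n"
    and eq: "A *\<^sub>v v = \<mu> \<cdot>\<^sub>v v"
    using A by (auto simp: spectrum_def eigenvalue_def eigenvector_def)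
  have "\<exists>l\<in>{..<n}. v $ l \<noteq> 0" using v by (auto intro!: eq_vecI)
  from exists_unit_multiple[OF _ this] obtain c where
    c: "(\<Sum>l<n. (c * v $ l) * cnj (c * v $ l)) = 1" by auto
  have "(\<Sum>l<n. c * v $ l * a i l) = \<mu> * (c * v $ i)" if "i < n" for i
  proof -
    have "(\<Sum>l<n. a i l * v $ l) = (A *\<^sub>v v) $ i"
      using v(1) that by (simp add: A_def scalar_prod_def lessThan_atLeast0)
    also have "\<dots> = \<mu> * v $ i" using v(1) that by (simp add: eq)
    finally have "c * (\<Sum>l<n. a i l * v $ l) = c * (\<mu> * v $ i)" by simp
    then show ?thesis by (simp add: sum_distrib_left mult_ac)
  qed
  with c show ?thesis by (intro exI[of _ "\<lambda>l. c * v $ l"] exI[of _ \<mu>]) auto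
qed

definition cross_forms ::
    "('a::complex_hilbert_space \<Rightarrow> 'a) list \<Rightarrow> 'a \<Rightarrow> ('a \<Rightarrow> complex) list" where
  "cross_forms As y = (\<lambda>w. cinner w y) # map (\<lambda>T w. cinner w (T y)) As @
     map (\<lambda>T w. cinner (T w) y) As"

lemma length_cross_forms [simp]: "length (cross_forms As y) = 2 * length As + 1"
  by (simp add: cross_forms_def)

lemma cross_forms_sum_scaleC:
  assumes "\<forall>T\<in>set As. bounded_clinear T" "c < length (cross_forms As y)"
  shows "(cross_forms As y ! c) (\<Sum>l\<in>I. s l *\<^sub>C x l) =
    (\<Sum>l\<in>I. s l * (cross_forms As y ! c) (x l))"
proof -
  have "\<phi> (\<Sum>l\<in>I. s l *\<^sub>C x l) = (\<Sum>l\<in>I. s l * \<phi> (x l))" if "\<phi> \<in> set (cross_forms As y)" for \<phi>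
    using that assms(1)
    by (auto simp: cross_forms_def cinner_sum_scaleC_left bounded_clinear_sum_scaleC)
  then show ?thesis using assms(2) nth_mem by blast
qed

lemma exists_diagonalizing_family:
  fixes As :: "('a::complex_hilbert_space \<Rightarrow> 'a) list" and e :: "nat \<Rightarrow> 'a"
  assumes As: "\<forall>T\<in>set As. bounded_clinear T" and "As \<noteq> []"
    and e: "orthonormal_on {..<n} e"
    and n: "n > 0" "R * (2 * length As + 1) \<le> n"
  shows "\<exists>x :: nat \<Rightarrow> 'a. orthonormal_on {..R} x \<and>
    (\<forall>T\<in>set As. \<forall>i\<le>R. \<forall>j\<le>R. i \<noteq> j \<longrightarrow> cinner (T (x i)) (x j) = 0)"
proof -
  define A where "A = As ! 0"
  have A: "bounded_clinear A" and As_eq: "As = A # tl As"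
    using As assms(2) by (auto simp: A_def neq_Nil_conv)
  obtain v \<mu> where v: "(\<Sum>l<n. v l * cnj (v l)) = 1"
    and eig: "\<And>i. i < n \<Longrightarrow> (\<Sum>l<n. v l * cinner (A (e l)) (e i)) = \<mu> * v i"
    using exists_unit_eigenvector[OF n(1), of "\<lambda>i l. cinner (A (e l)) (e i)"] by blast
  define x0 where "x0 = (\<Sum>l<n. v l *\<^sub>C e l)"
  have x0: "cinner x0 x0 = 1"
    using v by (simp add: x0_def cinner_orthonormal_combination[OF e])
  have A_x0: "cinner (A x0) w = \<mu> * cinner x0 w" if w: "w = (\<Sum>l<n. s l *\<^sub>C e l)" for w s
  proof -
    have "cinner (A x0) (e i) = \<mu> * v i" if "i < n" for i
      using eig[OF that] by (simp add: x0_def bounded_clinear_sum_scaleC[OF A] cinner_sum_scaleC_left)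
    then have "cinner (A x0) w = \<mu> * (\<Sum>l<n. v l * cnj (s l))"
      by (simp add: w cinner_sum_scaleC_right sum_distrib_left mult.assoc mult.commute[of _ "cnj _"]
          mult.left_commute[of _ "cnj _"])
    then show ?thesis by (simp add: w x0_def cinner_orthonormal_combination[OF e])
  qed
  have "\<exists>x. x 0 = x0 \<and> orthonormal_on {..<Suc r} x \<and>
      (\<forall>T\<in>set As. \<forall>i<Suc r. \<forall>j<Suc r. i \<noteq> j \<longrightarrow> cinner (T (x i)) (x j) = 0)" if "r \<le> R" for r
    using that
  proof (induction r)
    case 0
    then show ?case using x0 by (intro exI[of _ "\<lambda>_. x0"]) (simp add: orthonormal_on_def)
  next
    case (Suc r)
    then obtain x where x: "x 0 = x0" "orthonormal_on {..<Suc r} x"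
      and diag: "\<And>T i j. T \<in> set As \<Longrightarrow> i < Suc r \<Longrightarrow> j < Suc r \<Longrightarrow> i \<noteq> j \<Longrightarrow>
        cinner (T (x i)) (x j) = 0"
      by auto
    define F where "F = (\<lambda>(c, i). cross_forms As (x i) ! c)"
    let ?full = "{..<2 * length As + 1} \<times> {..<Suc r}"
    \<comment> \<open>Orthogonality to \<open>A x0\<close> follows from orthogonality to \<open>x0\<close>; dropping this one condition
      is what makes the dimension bound sharp enough.\<close>
    let ?J = "?full - {(1, 0)}"
    have "card ?full = (2 * length As + 1) * Suc r" by (simp only: card_cartesian_product card_lessThan)
    also have "\<dots> \<le> (2 * length As + 1) * R" using Suc.prems by (intro mult_le_mono2)
    also have "\<dots> \<le> n" using n(2) by (simp only: mult.commute)
    finally have "card ?full \<le> n" .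
    moreover have "card ?J = card ?full - 1" using assms(2) by (subst card_Diff_singleton) auto
    moreover have "card ?full > 0" by (subst card_gt_0_iff) auto
    ultimately have "card ?J + 1 \<le> card {..<n}" by simp
    from orthonormal_solutions[OF _ _ this, of "\<lambda>(c, i) l. F (c, i) (e l)"]
    obtain s :: "nat \<Rightarrow> nat \<Rightarrow> complex" where s: "(\<Sum>l<n. s 0 l * cnj (s 0 l)) = 1"
      and ker: "\<And>c i. (c, i) \<in> ?J \<Longrightarrow> (\<Sum>l<n. s 0 l * F (c, i) (e l)) = (0 :: complex)"
      by fastforce
    define w where "w = (\<Sum>l<n. s (0::nat) l *\<^sub>C e l)"
    have w1: "cinner w w = 1" by (simp add: w_def cinner_orthonormal_combination[OF e] s)
    have Fw: "F (c, i) w = 0" if "(c, i) \<in> ?J" for c i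
      using ker[OF that] that unfolding w_def F_def prod.case
      by (subst cross_forms_sum_scaleC[OF As]) auto
    have w_x: "cinner w (x i) = 0" if "i < Suc r" for i
      using Fw[of 0 i] that by (simp add: F_def cross_forms_def)
    have forms: "(cross_forms As (x i) ! c) w = 0" if "i < Suc r" "c < 2 * length As + 1" for c i
    proof (cases "(c, i) = (1, 0)")
      case True
      have "cross_forms As (x 0) ! 1 = (\<lambda>w. cinner w (A x0))"
        using x(1) by (subst As_eq) (simp add: cross_forms_def)
      moreover have "cinner w (A x0) = 0"
        using A_x0[OF w_def] w_x[of 0] x(1) by (metis cinner_eq_0_commute mult_zero_right zero_less_Suc)
      ultimately show ?thesis using True by simp
    next
      case False
      then show ?thesis using Fw[of c i] that by (simp add: F_def)
    qed
    have "\<phi> w = 0" if "i < Suc r" "\<phi> \<in> set (cross_forms As (x i))" for \<phi> i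
      using that forms[OF that(1)] by (auto simp: in_set_conv_nth)
    then have cross: "cinner w (T (x i)) = 0" "cinner (T w) (x i) = 0"
      if "T \<in> set As" "i < Suc r" for T i
      using that by (auto simp: cross_forms_def)
    have "orthonormal_on {..<Suc (Suc r)} (x(Suc r := w))"
      by (rule orthonormal_on_extend[OF x(2) w1 w_x])
    moreover have "cinner (T ((x(Suc r := w)) i)) ((x(Suc r := w)) j) = 0"
      if "T \<in> set As" "i < Suc (Suc r)" "j < Suc (Suc r)" "i \<noteq> j" for T i j
      using that diag cross cinner_eq_0_commute[of _ w] by (auto simp: less_Suc_eq[of _ "Suc r"])
    moreover have "(x(Suc r := w)) 0 = x0" using x(1) by simp
    ultimately show ?case by blast
  qed
  from this[of R] show ?thesis by (auto simp: lessThan_Suc_atMost less_Suc_eq_le)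
qed


section \<open>Compressions to tensor families\<close>

lemma cinner_eq_0_if_norm_sums:
  fixes x y :: "'a::complex_hilbert_space"
  assumes "cinner (x + y) (x + y) = cinner x x + cinner y y"
    and "cinner (x + \<i> *\<^sub>C y) (x + \<i> *\<^sub>C y) = cinner x x + cinner y y"
  shows "cinner x y = 0"
proof -
  have "cinner x y + cinner y x = 0"
    using assms(1) by (simp add: cinner_add_left cinner_add_right add.commute)
  moreover have "cinner x y = cinner y x"
    using assms(2)
    by (simp add: cinner_add_left cinner_add_right cinner_scaleC_left cinner_scaleC_right algebra_simps)
  ultimately show ?thesis by simp
qed

lemma linear_isometry_orthonormal:
  fixes X :: "complex vec \<Rightarrow> 'a::complex_hilbert_space"
  assumes X: "linear_isometry n X"
  shows "orthonormal_on {..<n} (\<lambda>k. X (unit_vec n k))"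
proof -
  have self: "cinner (X v) (X v) = complex_of_real (Re (v \<bullet>c v))" if "v \<in> carrier_vec n" for v
  proof -
    have "v \<bullet>c v \<ge> 0" by (rule conjugate_square_ge_0_vec)
    then have "Re (v \<bullet>c v) \<ge> 0" by (simp add: less_eq_complex_def)
    then show ?thesis using X that by (simp add: linear_isometry_def cinner_self)
  qed
  have unit: "unit_vec n k \<bullet>c v = cnj (v $ k)" if "k < n" "v \<in> carrier_vec n" for v k
    using that by simp
  have "cinner (X (unit_vec n k)) (X (unit_vec n l)) = 0" if kl: "k < n" "l < n" "k \<noteq> l" for k l
  proof (rule cinner_eq_0_if_norm_sums)
    let ?k = "unit_vec n k :: complex vec" and ?l = "unit_vec n l :: complex vec"
    have nrm: "cinner (X ?k + c *\<^sub>C X ?l) (X ?k + c *\<^sub>C X ?l) = cinner (X ?k) (X ?k) + cinner (X ?l) (X ?l)"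
      if "c * cnj c = 1" for c
    proof -
      have "X ?k + c *\<^sub>C X ?l = X (?k + c \<cdot>\<^sub>v ?l)" using X by (simp add: linear_isometry_def)
      moreover have "(?k + c \<cdot>\<^sub>v ?l) \<bullet>c (?k + c \<cdot>\<^sub>v ?l) = 2"
      proof -
        have "(?k + c \<cdot>\<^sub>v ?l) \<bullet>c (?k + c \<cdot>\<^sub>v ?l) =
            ?k \<bullet>c (?k + c \<cdot>\<^sub>v ?l) + c * (?l \<bullet>c (?k + c \<cdot>\<^sub>v ?l))"
          by (subst add_scalar_prod_distrib[of _ n]) auto
        then show ?thesis using kl that by (simp add: unit)
      qed
      moreover have "?k \<bullet>c ?k = 1" "?l \<bullet>c ?l = 1" using kl by (simp_all add: unit)
      ultimately show ?thesis by (simp add: self)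
    qed
    from nrm[of 1] show "cinner (X ?k + X ?l) (X ?k + X ?l) = cinner (X ?k) (X ?k) + cinner (X ?l) (X ?l)"
      by (metis complex_cnj_one cvs.scale_one mult_1)
    from nrm[of \<i>] show "cinner (X ?k + \<i> *\<^sub>C X ?l) (X ?k + \<i> *\<^sub>C X ?l) =
        cinner (X ?k) (X ?k) + cinner (X ?l) (X ?l)" by simp
  qed
  moreover have "cinner (X (unit_vec n k)) (X (unit_vec n k)) = 1" if "k < n" for k
    using that self[of "unit_vec n k"] by (simp add: unit)
  ultimately show ?thesis by (auto simp: orthonormal_on_def)
qed

lemma cadjoint_nth:
  assumes X: "linear_isometry n X" and k: "k < n"
  shows "cadjoint n X h $ k = cinner h (X (unit_vec n k))"
proof -
  have ad: "is_cadjoint n X (cadjoint n X)" by (rule is_cadjoint_cadjoint[OF X])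
  then have c: "cadjoint n X h \<in> carrier_vec n" by (simp add: is_cadjoint_def)
  have "cinner (X (unit_vec n k)) h = unit_vec n k \<bullet>c cadjoint n X h"
    using ad by (simp add: is_cadjoint_def)
  also have "\<dots> = cnj (cadjoint n X h $ k)" using c k by simp
  finally show ?thesis by (metis cinner_commute complex_cnj_cnj)
qed

lemma linear_isometry_sum_orthonormal:
  assumes x: "orthonormal_on {..<n} x"
  shows "linear_isometry n (\<lambda>v. \<Sum>l<n. v $ l *\<^sub>C x l)"
  unfolding linear_isometry_def
proof (intro conjI ballI allI)
  fix v w :: "complex vec" and c
  assume v: "v \<in> carrier_vec n" and w: "w \<in> carrier_vec n"
  show "(\<Sum>l<n. (v + w) $ l *\<^sub>C x l) = (\<Sum>l<n. v $ l *\<^sub>C x l) + (\<Sum>l<n. w $ l *\<^sub>C x l)"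
    using v w by (simp add: scaleC_add_left sum.distrib)
next
  fix v :: "complex vec" and c
  assume v: "v \<in> carrier_vec n"
  show "(\<Sum>l<n. (c \<cdot>\<^sub>v v) $ l *\<^sub>C x l) = c *\<^sub>C (\<Sum>l<n. v $ l *\<^sub>C x l)"
    using v by (simp add: scaleC_scaleC cvs.scale_sum_right)
  have "complex_of_real ((norm (\<Sum>l<n. v $ l *\<^sub>C x l))\<^sup>2) = (\<Sum>l<n. v $ l * cnj (v $ l))"
    by (simp only: cinner_self[symmetric]) (simp add: cinner_orthonormal_combination[OF x])
  also have "\<dots> = v \<bullet>c v" using v by (simp add: scalar_prod_def lessThan_atLeast0)
  finally have "Re (v \<bullet>c v) = (norm (\<Sum>l<n. v $ l *\<^sub>C x l))\<^sup>2" by (metis Re_complex_of_real)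
  then show "norm (\<Sum>l<n. v $ l *\<^sub>C x l) = sqrt (Re (v \<bullet>c v))" by simp
qed

lemma isometric_compression_iff:
  fixes As :: "('a::complex_hilbert_space \<Rightarrow> 'a) list"
  assumes As: "\<forall>T\<in>set As. bounded_clinear T"
    and M: "\<And>j. j < length As \<Longrightarrow> M j \<in> carrier_mat n n"
  shows "(\<exists>X. linear_isometry n X \<and> (\<forall>j<length As. \<forall>v\<in>carrier_vec n.
      cadjoint n X ((As ! j) (X v)) = M j *\<^sub>v v)) \<longleftrightarrow>
    (\<exists>x. orthonormal_on {..<n} x \<and> (\<forall>j<length As. \<forall>k<n. \<forall>l<n.
      cinner ((As ! j) (x l)) (x k) = M j $$ (k, l)))" (is "?L \<longleftrightarrow> ?R")
proof
  assume ?L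
  then obtain X where X: "linear_isometry n X"
    and eq: "\<And>j v. j < length As \<Longrightarrow> v \<in> carrier_vec n \<Longrightarrow> cadjoint n X ((As ! j) (X v)) = M j *\<^sub>v v"
    by blast
  have "cinner ((As ! j) (X (unit_vec n l))) (X (unit_vec n k)) = M j $$ (k, l)"
    if "j < length As" "k < n" "l < n" for j k l
    using cadjoint_nth[OF X that(2), of "(As ! j) (X (unit_vec n l))"] eq[OF that(1), of "unit_vec n l"]
      M[OF that(1)] that by simp
  then show ?R using linear_isometry_orthonormal[OF X] by blast
next
  assume ?R
  then obtain x where x: "orthonormal_on {..<n} x"
    and eq: "\<And>j k l. j < length As \<Longrightarrow> k < n \<Longrightarrow> l < n \<Longrightarrow> cinner ((As ! j) (x l)) (x k) = M j $$ (k, l)"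
    by blast
  define X where "X v = (\<Sum>l<n. v $ l *\<^sub>C x l)" for v :: "complex vec"
  have X: "linear_isometry n X"
    unfolding X_def by (rule linear_isometry_sum_orthonormal[OF x])
  have X_unit: "X (unit_vec n k) = x k" if "k < n" for k
  proof -
    have "X (unit_vec n k) = (\<Sum>l<n. if l = k then x l else 0)"
      unfolding X_def using that by (intro sum.cong) auto
    then show ?thesis using that by simp
  qed
  have "cadjoint n X ((As ! j) (X v)) = M j *\<^sub>v v" if j: "j < length As" and v: "v \<in> carrier_vec n" for j v
  proof (rule eq_vecI)
    have "cadjoint n X h \<in> carrier_vec n" for h
      using is_cadjoint_cadjoint[OF X] by (simp add: is_cadjoint_def)
    then show "dim_vec (cadjoint n X ((As ! j) (X v))) = dim_vec (M j *\<^sub>v v)"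
      using M[OF j] by auto
    fix k assume "k < dim_vec (M j *\<^sub>v v)"
    then have k: "k < n" using M[OF j] by simp
    have "cadjoint n X ((As ! j) (X v)) $ k = cinner ((As ! j) (X v)) (x k)"
      by (simp add: cadjoint_nth[OF X k] X_unit[OF k])
    also have "\<dots> = (\<Sum>l<n. v $ l * cinner ((As ! j) (x l)) (x k))"
      unfolding X_def using bspec[OF As nth_mem[OF j]]
      by (simp add: bounded_clinear_sum_scaleC cinner_sum_scaleC_left)
    also have "\<dots> = (\<Sum>l<n. M j $$ (k, l) * v $ l)"
      using eq[OF j k] by (simp add: mult.commute)
    also have "\<dots> = (M j *\<^sub>v v) $ k"
      using M[OF j] v k by (simp add: scalar_prod_def lessThan_atLeast0)
    finally show "cadjoint n X ((As ! j) (X v)) $ k = (M j *\<^sub>v v) $ k" .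
  qed
  with X show ?L by blast
qed

definition tensor_compression ::
    "nat \<Rightarrow> nat \<Rightarrow> (nat \<times> nat \<Rightarrow> 'a::complex_hilbert_space) \<Rightarrow> ('a \<Rightarrow> 'a) \<Rightarrow>
      (nat \<Rightarrow> nat \<Rightarrow> complex) \<Rightarrow> bool" where
  "tensor_compression p q x T B \<longleftrightarrow> (\<forall>i<p. \<forall>i'<p. \<forall>a<q. \<forall>a'<q.
     cinner (T (x (i', a'))) (x (i, a)) = of_bool (i = i') * B a a')"

definition tensor_orthonormal :: "nat \<Rightarrow> nat \<Rightarrow> (nat \<times> nat \<Rightarrow> 'a::complex_hilbert_space) \<Rightarrow> bool" where
  "tensor_orthonormal p q x \<longleftrightarrow> tensor_compression p q x id (\<lambda>a a'. of_bool (a = a'))"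

lemma div_mult_add_less: "i < p \<Longrightarrow> a < q \<Longrightarrow> i * q + a < p * (q::nat)"
  using mult_le_mono1[of "Suc i" p q] by simp

lemma mult_add_eq_iff:
  assumes "a < q" "a' < (q::nat)"
  shows "i * q + a = i' * q + a' \<longleftrightarrow> i = i' \<and> a = a'"
proof
  assume eq: "i * q + a = i' * q + a'"
  show "i = i' \<and> a = a'"
    using arg_cong[OF eq, of "\<lambda>k. k div q"] arg_cong[OF eq, of "\<lambda>k. k mod q"] assms by simp
qed simp

lemma matricial_range_iff:
  fixes As :: "('a::complex_hilbert_space \<Rightarrow> 'a) list"
  assumes As: "\<forall>T\<in>set As. bounded_clinear T"
  shows "Bs \<in> matricial_range p q As \<longleftrightarrow> length Bs = length As \<and> set Bs \<subseteq> carrier_mat q q \<and>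
    (\<exists>x. tensor_orthonormal p q x \<and>
      (\<forall>j<length As. tensor_compression p q x (As ! j) (\<lambda>a a'. Bs ! j $$ (a, a'))))"
proof (cases "length Bs = length As \<and> set Bs \<subseteq> carrier_mat q q")
  case True
  then have B: "Bs ! j \<in> carrier_mat q q" if "j < length As" for j
    using that by (metis nth_mem subset_code(1))
  have kron: "kronecker (1\<^sub>m p) (Bs ! j) \<in> carrier_mat (p * q) (p * q)"
    "\<And>k l. k < p * q \<Longrightarrow> l < p * q \<Longrightarrow> kronecker (1\<^sub>m p) (Bs ! j) $$ (k, l) =
      of_bool (k div q = l div q) * Bs ! j $$ (k mod q, l mod q)"
    if "j < length As" for j
    using B[OF that] by (auto simp: kronecker_def less_mult_imp_div_less)
  have "Bs \<in> matricial_range p q As \<longleftrightarrow> (\<exists>X. linear_isometry (p * q) X \<and>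
         (\<forall>j<length As. \<forall>v\<in>carrier_vec (p * q).
            cadjoint (p * q) X ((As ! j) (X v)) = kronecker (1\<^sub>m p) (Bs ! j) *\<^sub>v v))"
    using True by (simp add: matricial_range_def)
  also have "\<dots> \<longleftrightarrow> (\<exists>x. orthonormal_on {..<p * q} x \<and> (\<forall>j<length As. \<forall>k<p * q. \<forall>l<p * q.
      cinner ((As ! j) (x l)) (x k) = kronecker (1\<^sub>m p) (Bs ! j) $$ (k, l)))"
    by (rule isometric_compression_iff[OF As kron(1)])
  also have "\<dots> \<longleftrightarrow> (\<exists>x. tensor_orthonormal p q x \<and>
      (\<forall>j<length As. tensor_compression p q x (As ! j) (\<lambda>a a'. Bs ! j $$ (a, a'))))"
  proof (intro iffI; elim exE conjE)
    fix x :: "nat \<Rightarrow> 'a"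
    assume x: "orthonormal_on {..<p * q} x" "\<forall>j<length As. \<forall>k<p * q. \<forall>l<p * q.
      cinner ((As ! j) (x l)) (x k) = kronecker (1\<^sub>m p) (Bs ! j) $$ (k, l)"
    have "tensor_orthonormal p q (\<lambda>(i, a). x (i * q + a))"
      using x(1) by (auto simp: tensor_orthonormal_def tensor_compression_def orthonormal_on_def
          div_mult_add_less mult_add_eq_iff)
    moreover have "tensor_compression p q (\<lambda>(i, a). x (i * q + a)) (As ! j) (\<lambda>a a'. Bs ! j $$ (a, a'))"
      if "j < length As" for j
      using x(2) that kron(2)[OF that] by (auto simp: tensor_compression_def div_mult_add_less)
    ultimately show "\<exists>x. tensor_orthonormal p q x \<and>
      (\<forall>j<length As. tensor_compression p q x (As ! j) (\<lambda>a a'. Bs ! j $$ (a, a')))" by blast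
  next
    fix x
    assume x: "tensor_orthonormal p q x"
      "\<forall>j<length As. tensor_compression p q x (As ! j) (\<lambda>a a'. Bs ! j $$ (a, a'))"
    have dm: "k div q < p" "k mod q < q" if "k < p * q" for k
      using that by (auto simp: less_mult_imp_div_less intro!: mod_less_divisor gr0I)
    have inj: "k = l \<longleftrightarrow> k div q = l div q \<and> k mod q = l mod q" for k l
      by (metis div_mult_mod_eq)
    have "orthonormal_on {..<p * q} (\<lambda>k. x (k div q, k mod q))"
      unfolding orthonormal_on_def
    proof (intro ballI)
      fix k l assume "k \<in> {..<p * q}" "l \<in> {..<p * q}"
      then show "cinner (x (k div q, k mod q)) (x (l div q, l mod q)) = of_bool (k = l)"
        using x(1) dm[of k] dm[of l] unfolding inj[of k l]
        by (auto simp: tensor_orthonormal_def tensor_compression_def)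
    qed
    moreover have "cinner ((As ! j) (x (l div q, l mod q))) (x (k div q, k mod q)) =
        kronecker (1\<^sub>m p) (Bs ! j) $$ (k, l)" if "j < length As" "k < p * q" "l < p * q" for j k l
      using x(2) that kron(2)[OF that] dm[OF that(2)] dm[OF that(3)] by (simp add: tensor_compression_def)
    ultimately show "\<exists>x. orthonormal_on {..<p * q} x \<and> (\<forall>j<length As. \<forall>k<p * q. \<forall>l<p * q.
      cinner ((As ! j) (x l)) (x k) = kronecker (1\<^sub>m p) (Bs ! j) $$ (k, l))" by blast
  qed
  finally show ?thesis using True by simp
next
  case False
  then show ?thesis by (auto simp: matricial_range_def)
qed

lemma rank_range_iff:
  fixes As :: "('a::complex_hilbert_space \<Rightarrow> 'a) list"
  assumes As: "\<forall>T\<in>set As. bounded_clinear T"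
  shows "cs \<in> rank_range k As \<longleftrightarrow> length cs = length As \<and>
    (\<exists>x. orthonormal_on {..<k} x \<and>
      (\<forall>j<length As. \<forall>i<k. \<forall>i'<k. cinner ((As ! j) (x i')) (x i) = of_bool (i = i') * cs ! j))"
proof -
  have "(\<exists>X. linear_isometry k X \<and> (\<forall>j<length As. \<forall>v\<in>carrier_vec k.
      cadjoint k X ((As ! j) (X v)) = (cs ! j \<cdot>\<^sub>m 1\<^sub>m k) *\<^sub>v v)) \<longleftrightarrow>
    (\<exists>x. orthonormal_on {..<k} x \<and> (\<forall>j<length As. \<forall>i<k. \<forall>i'<k.
      cinner ((As ! j) (x i')) (x i) = (cs ! j \<cdot>\<^sub>m 1\<^sub>m k) $$ (i, i')))"
    by (rule isometric_compression_iff[OF As]) auto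
  also have "\<dots> \<longleftrightarrow> (\<exists>x. orthonormal_on {..<k} x \<and>
      (\<forall>j<length As. \<forall>i<k. \<forall>i'<k. cinner ((As ! j) (x i')) (x i) = of_bool (i = i') * cs ! j))"
  proof -
    have "(cs ! j \<cdot>\<^sub>m 1\<^sub>m k) $$ (i, i') = of_bool (i = i') * cs ! j" if "i < k" "i' < k" for i i' j
      using that by (cases "i = i'") auto
    then show ?thesis
      by (intro ex_cong1 arg_cong2[where f = "(\<and>)"] refl all_cong arg_cong2[where f = "(=)"])
  qed
  finally show ?thesis by (simp only: rank_range_def mem_Collect_eq)
qed

lemma cinner_block_combination:
  fixes x :: "nat \<Rightarrow> 'a::complex_hilbert_space" and f :: "nat \<Rightarrow> 'j"
  assumes T: "bounded_clinear T"
    and diag: "\<And>i i'. i < N \<Longrightarrow> i' < N \<Longrightarrow> i \<noteq> i' \<Longrightarrow> cinner (T (x i)) (x i') = 0"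
    and \<theta>: "\<And>i. i < N \<Longrightarrow> 0 \<le> \<theta> i"
  defines "z \<equiv> \<lambda>j. \<Sum>i | i < N \<and> f i = j. complex_of_real (sqrt (\<theta> i)) *\<^sub>C x i"
  shows "cinner (T (z j')) (z j) =
    of_bool (j = j') * (\<Sum>i | i < N \<and> f i = j. complex_of_real (\<theta> i) * cinner (T (x i)) (x i))"
proof -
  define r where "r i = complex_of_real (sqrt (\<theta> i))" for i
  let ?I = "\<lambda>j. {i. i < N \<and> f i = j}"
  have r: "r i * cnj (r i) = complex_of_real (\<theta> i)" if "i < N" for i
    using \<theta>[OF that] by (simp add: r_def flip: of_real_mult)
  have "cinner (T (z j')) (z j) = (\<Sum>l\<in>?I j'. \<Sum>k\<in>?I j. r l * cnj (r k) * cinner (T (x l)) (x k))"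
    unfolding z_def r_def[symmetric] by (rule cinner_bounded_clinear_combination[OF T])
  also have "\<dots> = (\<Sum>l\<in>?I j'. \<Sum>k\<in>?I j. if k = l then complex_of_real (\<theta> l) * cinner (T (x l)) (x l) else 0)"
    by (intro sum.cong refl) (auto simp: diag r)
  also have "\<dots> = (\<Sum>l\<in>?I j'. of_bool (j = j') * (complex_of_real (\<theta> l) * cinner (T (x l)) (x l)))"
    by (intro sum.cong refl) auto
  finally show ?thesis by (auto simp: sum_distrib_left)
qed

lemma rank_range_nonempty:
  fixes As :: "('a::complex_hilbert_space \<Rightarrow> 'a) list"
  assumes As: "\<forall>T\<in>set As. bounded_clinear T" and "As \<noteq> []" and k: "k \<ge> 2"
    and dim: "enat ((k - 1) * (2 * length As + 1)\<^sup>2) \<le> cdim TYPE('a)"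
  shows "rank_range k As \<noteq> {}"
proof -
  define m where "m = length As"
  define R where "R = (k - 1) * (2 * m + 1)"
  define n where "n = (k - 1) * (2 * m + 1)\<^sup>2"
  obtain e :: "nat \<Rightarrow> 'a" where e: "orthonormal_on {..<n} e"
    using dim exists_orthonormal_family unfolding enat_le_cdim_iff n_def m_def by blast
  have "n > 0" using k by (simp add: n_def)
  moreover have "R * (2 * length As + 1) \<le> n"
    unfolding n_def R_def m_def power2_eq_square by (simp only: mult.assoc order_refl)
  ultimately obtain x where x: "orthonormal_on {..R} x"
    and diag: "\<And>T i j. T \<in> set As \<Longrightarrow> i \<le> R \<Longrightarrow> j \<le> R \<Longrightarrow> i \<noteq> j \<Longrightarrow> cinner (T (x i)) (x j) = 0"
    using exists_diagonalizing_family[OF As assms(2) e] by blast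
  define y where "y i c = (let d = cinner ((As ! (c mod m)) (x i)) (x i) in if c < m then Re d else Im d)"
    for i c
  define N where "N = R + 1"
  have N: "(k - 1) * (2 * m + 1) + 1 = N" by (simp only: N_def R_def)
  have "k \<ge> 1" using k by simp
  from tverberg[OF this, of "2 * m" y, unfolded N]
  obtain f \<theta> b where tv: "\<forall>i<N. 0 \<le> \<theta> i" "\<forall>j<k. (\<Sum>i | i < N \<and> f i = j. \<theta> i) = 1 \<and>
      (\<forall>c<2 * m. (\<Sum>i | i < N \<and> f i = j. \<theta> i * y i c) = b c)"
    by blast
  have \<theta>: "0 \<le> \<theta> i" if "i < N" for i using tv(1) that by blast
  have sum1: "(\<Sum>i | i < N \<and> f i = j. \<theta> i) = 1" if "j < k" for j using tv(2) that by blast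
  have bary: "(\<Sum>i | i < N \<and> f i = j. \<theta> i * y i c) = b c" if "j < k" "c < 2 * m" for j c
    using tv(2) that by blast
  define z where "z j = (\<Sum>i | i < N \<and> f i = j. complex_of_real (sqrt (\<theta> i)) *\<^sub>C x i)" for j
  have xN: "cinner (id (x i)) (x i') = of_bool (i = i')" if "i < N" "i' < N" for i i'
    using x that by (simp add: orthonormal_on_def N_def)
  have "cinner (id (z j)) (z j') = of_bool (j = j')" if j: "j < k" "j' < k" for j j'
  proof -
    have "cinner (id (z j)) (z j') = of_bool (j' = j) *
        (\<Sum>i | i < N \<and> f i = j'. complex_of_real (\<theta> i) * cinner (id (x i)) (x i))"
      unfolding z_def by (rule cinner_block_combination[OF bounded_clinear_id]) (simp_all add: xN \<theta> del: id_apply)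
    also have "(\<Sum>i | i < N \<and> f i = j'. complex_of_real (\<theta> i) * cinner (id (x i)) (x i)) =
        complex_of_real (\<Sum>i | i < N \<and> f i = j'. \<theta> i)"
      unfolding of_real_sum by (intro sum.cong refl) (simp add: xN del: id_apply)
    finally show ?thesis using j by (auto simp: sum1)
  qed
  then have z: "orthonormal_on {..<k} z" by (simp add: orthonormal_on_def)
  define cs where "cs = map (\<lambda>l. Complex (b l) (b (m + l))) [0..<m]"
  have "cinner ((As ! l) (z j')) (z j) = of_bool (j = j') * cs ! l"
    if l: "l < m" and j: "j < k" for l j j'
  proof -
    have T: "As ! l \<in> set As" using l by (simp add: m_def)
    let ?d = "\<lambda>i. cinner ((As ! l) (x i)) (x i)"
    have "cinner ((As ! l) (z j')) (z j) =
        of_bool (j = j') * (\<Sum>i | i < N \<and> f i = j. complex_of_real (\<theta> i) * ?d i)"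
      unfolding z_def using diag[OF T]
      by (intro cinner_block_combination bspec[OF As T] \<theta>) (simp_all add: N_def)
    also have "(\<Sum>i | i < N \<and> f i = j. complex_of_real (\<theta> i) * ?d i) = cs ! l"
    proof (rule complex_eqI)
      show "Re (\<Sum>i | i < N \<and> f i = j. complex_of_real (\<theta> i) * ?d i) = Re (cs ! l)"
      proof -
        have "y i l = Re (?d i)" for i using l by (simp add: y_def)
        then show ?thesis using bary[OF j, of l] l by (simp add: cs_def)
      qed
      show "Im (\<Sum>i | i < N \<and> f i = j. complex_of_real (\<theta> i) * ?d i) = Im (cs ! l)"
      proof -
        have "y i (m + l) = Im (?d i)" for i using l by (simp add: y_def)
        then show ?thesis using bary[OF j, of "m + l"] l by (simp add: cs_def)
      qed
    qed
    finally show ?thesis .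
  qed
  with z have "cs \<in> rank_range k As"
    by (auto simp: rank_range_iff[OF As] cs_def m_def)
  then show ?thesis by blast
qed

lemma tensor_compression_combination:
  assumes T: "bounded_clinear T" and Z: "tensor_compression P r Z T B"
    and s: "\<And>i i'. i < p \<Longrightarrow> i' < p \<Longrightarrow> (\<Sum>l<P. s i l * cnj (s i' l)) = of_bool (i = i')"
  shows "tensor_compression p r (\<lambda>(i, a). \<Sum>l<P. s i l *\<^sub>C Z (l, a)) T B"
  unfolding tensor_compression_def
proof (intro allI impI)
  fix i i' a a' assume lt: "i < p" "i' < p" "a < r" "a' < r"
  have "cinner (T (\<Sum>l<P. s i' l *\<^sub>C Z (l, a'))) (\<Sum>l<P. s i l *\<^sub>C Z (l, a)) =
      (\<Sum>l<P. \<Sum>k<P. s i' l * cnj (s i k) * cinner (T (Z (l, a'))) (Z (k, a)))"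
    by (rule cinner_bounded_clinear_combination[OF T])
  also have "\<dots> = (\<Sum>l<P. \<Sum>k<P. if k = l then s i' l * cnj (s i l) * B a a' else 0)"
    using Z lt by (intro sum.cong refl) (auto simp: tensor_compression_def)
  also have "\<dots> = (\<Sum>l<P. s i' l * cnj (s i l)) * B a a'"
    by (simp add: sum_distrib_right)
  finally show "cinner (T ((\<lambda>(i, a). \<Sum>l<P. s i l *\<^sub>C Z (l, a)) (i', a')))
      ((\<lambda>(i, a). \<Sum>l<P. s i l *\<^sub>C Z (l, a)) (i, a)) = of_bool (i = i') * B a a'"
    using s[OF lt(2,1)] by (simp add: eq_commute[of i' i])
qed

lemma exists_tensor_subfamily:
  fixes As :: "('a::complex_hilbert_space \<Rightarrow> 'a) list" and Z :: "nat \<times> nat \<Rightarrow> 'a"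
  assumes As: "\<forall>T\<in>set As. bounded_clinear T" and V: "finite V"
    and dim: "(2 * length As + 1) * card V * r + p \<le> P"
  shows "\<exists>W. (\<forall>T B. bounded_clinear T \<longrightarrow> tensor_compression P r Z T B \<longrightarrow> tensor_compression p r W T B) \<and>
    (\<forall>i<p. \<forall>a<r. \<forall>v\<in>V. \<forall>\<phi>\<in>set (cross_forms As (X v)). \<phi> (W (i, a)) = 0)"
proof -
  define F where "F = (\<lambda>((c, v), a) l. (cross_forms As (X v) ! c) (Z (l, a)))"
  let ?J = "({..<2 * length As + 1} \<times> V) \<times> {..<r}"
  have "finite ?J" using V by blast
  have "card ?J + p \<le> card {..<P}"
    using dim by (simp only: card_cartesian_product card_lessThan)
  from orthonormal_solutions[OF \<open>finite ?J\<close> finite_lessThan this, of F]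
  obtain s :: "nat \<Rightarrow> nat \<Rightarrow> complex" where
    s: "\<forall>i<p. \<forall>i'<p. (\<Sum>l<P. s i l * cnj (s i' l)) = of_bool (i = i')"
    and ker: "\<forall>i<p. \<forall>j\<in>?J. (\<Sum>l<P. s i l * F j l) = 0"
    by blast
  define W where "W = (\<lambda>(i, a). \<Sum>l<P. s i l *\<^sub>C Z (l, a))"
  have "tensor_compression p r W T B" if "bounded_clinear T" "tensor_compression P r Z T B" for T B
    unfolding W_def using s by (intro tensor_compression_combination that) blast
  moreover have "\<phi> (W (i, a)) = 0"
    if lt: "i < p" "a < r" "v \<in> V" and \<phi>: "\<phi> \<in> set (cross_forms As (X v))" for i a v \<phi>
  proof -
    obtain c where c: "c < length (cross_forms As (X v))" "\<phi> = cross_forms As (X v) ! c"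
      using \<phi> by (auto simp: in_set_conv_nth)
    have "((c, v), a) \<in> ?J" using c lt by simp
    then have "(\<Sum>l<P. s i l * F ((c, v), a) l) = 0" using ker lt(1) by blast
    moreover have "\<phi> (W (i, a)) = (\<Sum>l<P. s i l * F ((c, v), a) l)"
      unfolding c(2) W_def F_def prod.case by (rule cross_forms_sum_scaleC[OF As c(1)])
    ultimately show ?thesis by simp
  qed
  ultimately show ?thesis by blast
qed

lemma tensor_compression_mix:
  assumes T: "bounded_clinear T"
    and W: "tensor_compression p q W T C" and X: "tensor_compression p q X T B"
    and cross: "\<And>u v. u \<in> {..<p} \<times> {..<q} \<Longrightarrow> v \<in> {..<p} \<times> {..<q} \<Longrightarrow>
      cinner (T (W u)) (X v) = 0 \<and> cinner (W u) (T (X v)) = 0"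
    and t: "0 \<le> t" "t \<le> 1"
  shows "tensor_compression p q
    (\<lambda>u. complex_of_real (sqrt t) *\<^sub>C W u + complex_of_real (sqrt (1 - t)) *\<^sub>C X u) T
    (\<lambda>a a'. complex_of_real t * C a a' + complex_of_real (1 - t) * B a a')"
  unfolding tensor_compression_def
proof (intro allI impI)
  fix i i' a a' assume lt: "i < p" "i' < p" "a < q" "a' < q"
  define s s' where "s = complex_of_real (sqrt t)" and "s' = complex_of_real (sqrt (1 - t))"
  have s: "s * cnj s = complex_of_real t" "s' * cnj s' = complex_of_real (1 - t)"
    using t by (simp_all add: s_def s'_def flip: of_real_mult)
  have "cinner (T (s *\<^sub>C W (i', a') + s' *\<^sub>C X (i', a'))) (s *\<^sub>C W (i, a) + s' *\<^sub>C X (i, a)) =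
      (s * cnj s) * cinner (T (W (i', a'))) (W (i, a)) + (s' * cnj s') * cinner (T (X (i', a'))) (X (i, a)) +
      s * cnj s' * cinner (T (W (i', a'))) (X (i, a)) + s' * cnj s * cinner (T (X (i', a'))) (W (i, a))"
    by (simp add: bounded_clinear_add[OF T] bounded_clinear_scaleC[OF T] cinner_add_left
        cinner_add_right cinner_scaleC_left cinner_scaleC_right algebra_simps)
  also have "\<dots> = of_bool (i = i') * (complex_of_real t * C a a' + complex_of_real (1 - t) * B a a')"
  proof -
    have "cinner (T (W (i', a'))) (X (i, a)) = 0" "cinner (T (X (i', a'))) (W (i, a)) = 0"
      using cross[of "(i', a')" "(i, a)"] cross[of "(i, a)" "(i', a')"] lt
        cinner_eq_0_commute[of "W (i, a)"] by auto
    moreover have "cinner (T (W (i', a'))) (W (i, a)) = of_bool (i = i') * C a a'"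
      using W lt by (simp add: tensor_compression_def)
    moreover have "cinner (T (X (i', a'))) (X (i, a)) = of_bool (i = i') * B a a'"
      using X lt by (simp add: tensor_compression_def)
    ultimately show ?thesis unfolding s by (cases "i = i'") simp_all
  qed
  finally show "cinner (T (complex_of_real (sqrt t) *\<^sub>C W (i', a') + complex_of_real (sqrt (1 - t)) *\<^sub>C X (i', a')))
      (complex_of_real (sqrt t) *\<^sub>C W (i, a) + complex_of_real (sqrt (1 - t)) *\<^sub>C X (i, a)) =
      of_bool (i = i') * (complex_of_real t * C a a' + complex_of_real (1 - t) * B a a')"
    by (simp add: s_def s'_def)
qed

lemma star_center_matricial_rangeI:
  fixes As :: "('a::complex_hilbert_space \<Rightarrow> 'a) list"
  assumes As: "\<forall>T\<in>set As. bounded_clinear T"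
    and Cs: "length Cs = length As" "set Cs \<subseteq> carrier_mat q q"
    and ex: "\<And>X :: nat \<times> nat \<Rightarrow> 'a. \<exists>W. tensor_orthonormal p q W \<and>
      (\<forall>j<length As. tensor_compression p q W (As ! j) (\<lambda>a a'. Cs ! j $$ (a, a'))) \<and>
      (\<forall>i<p. \<forall>a<q. \<forall>v\<in>{..<p} \<times> {..<q}. \<forall>\<phi>\<in>set (cross_forms As (X v)). \<phi> (W (i, a)) = 0)"
  shows "star_center (matricial_range p q As) Cs"
  unfolding star_center_def
proof (intro conjI ballI allI impI)
  show "Cs \<in> matricial_range p q As"
    using Cs ex[of "\<lambda>_. 0"] by (auto simp: matricial_range_iff[OF As])
next
  fix Bs and t :: real
  assume Bs: "Bs \<in> matricial_range p q As" and t: "0 \<le> t \<and> t \<le> 1"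
  let ?D = "map2 (\<lambda>C B. complex_of_real t \<cdot>\<^sub>m C + complex_of_real (1 - t) \<cdot>\<^sub>m B) Cs Bs"
  obtain X where len: "length Bs = length As" and B: "set Bs \<subseteq> carrier_mat q q"
    and X: "tensor_orthonormal p q X"
      "\<And>j. j < length As \<Longrightarrow> tensor_compression p q X (As ! j) (\<lambda>a a'. Bs ! j $$ (a, a'))"
    using Bs unfolding matricial_range_iff[OF As] by blast
  obtain W where W: "tensor_orthonormal p q W"
      "\<And>j. j < length As \<Longrightarrow> tensor_compression p q W (As ! j) (\<lambda>a a'. Cs ! j $$ (a, a'))"
    and W0: "\<And>u v \<phi>. u \<in> {..<p} \<times> {..<q} \<Longrightarrow> v \<in> {..<p} \<times> {..<q} \<Longrightarrow>
      \<phi> \<in> set (cross_forms As (X v)) \<Longrightarrow> \<phi> (W u) = 0"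
    using ex[of X] by fast
  define Y where "Y u = complex_of_real (sqrt t) *\<^sub>C W u + complex_of_real (sqrt (1 - t)) *\<^sub>C X u" for u
  have D: "?D ! j \<in> carrier_mat q q"
    "\<And>a a'. a < q \<Longrightarrow> a' < q \<Longrightarrow> ?D ! j $$ (a, a') =
      complex_of_real t * Cs ! j $$ (a, a') + complex_of_real (1 - t) * Bs ! j $$ (a, a')"
    if j: "j < length As" for j
  proof -
    have "Cs ! j \<in> carrier_mat q q" "Bs ! j \<in> carrier_mat q q"
      using Cs B len j by (metis nth_mem subset_code(1))+
    then show "?D ! j \<in> carrier_mat q q"
      "\<And>a a'. a < q \<Longrightarrow> a' < q \<Longrightarrow> ?D ! j $$ (a, a') =
        complex_of_real t * Cs ! j $$ (a, a') + complex_of_real (1 - t) * Bs ! j $$ (a, a')"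
      using Cs(1) len j by auto
  qed
  have "cinner (W u) (X v) = 0" if "u \<in> {..<p} \<times> {..<q}" "v \<in> {..<p} \<times> {..<q}" for u v
    using W0[OF that, of "\<lambda>w. cinner w (X v)"] by (simp add: cross_forms_def)
  then have "tensor_compression p q Y id (\<lambda>a a'. complex_of_real t * of_bool (a = a') +
      complex_of_real (1 - t) * of_bool (a = a'))"
    unfolding Y_def using W(1) X(1) t
    by (intro tensor_compression_mix bounded_clinear_id) (auto simp: tensor_orthonormal_def)
  then have Y1: "tensor_orthonormal p q Y"
    by (simp add: tensor_orthonormal_def tensor_compression_def algebra_simps)
  have Y2: "tensor_compression p q Y (As ! j) (\<lambda>a a'. ?D ! j $$ (a, a'))" if j: "j < length As" for j
  proof -
    have T: "As ! j \<in> set As" using j by simp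
    have "cinner ((As ! j) (W u)) (X v) = 0 \<and> cinner (W u) ((As ! j) (X v)) = 0"
      if "u \<in> {..<p} \<times> {..<q}" "v \<in> {..<p} \<times> {..<q}" for u v
      using W0[OF that, of "\<lambda>w. cinner ((As ! j) w) (X v)"] W0[OF that, of "\<lambda>w. cinner w ((As ! j) (X v))"] T
      by (auto simp: cross_forms_def)
    then have "tensor_compression p q Y (As ! j) (\<lambda>a a'. complex_of_real t * Cs ! j $$ (a, a') +
        complex_of_real (1 - t) * Bs ! j $$ (a, a'))"
      unfolding Y_def using t W(2)[OF j] X(2)[OF j] by (intro tensor_compression_mix bspec[OF As T]) auto
    then show ?thesis using D(2)[OF j] by (simp add: tensor_compression_def)
  qed
  have "length ?D = length As" using Cs(1) len by simp
  moreover have "set ?D \<subseteq> carrier_mat q q"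
    using D(1) \<open>length ?D = length As\<close> unfolding set_conv_nth by auto
  ultimately show "?D \<in> matricial_range p q As"
    using Y1 Y2 unfolding matricial_range_iff[OF As] by blast
qed

lemma rank_range_star_center:
  fixes As :: "('a::complex_hilbert_space \<Rightarrow> 'a) list"
  assumes As: "\<forall>T\<in>set As. bounded_clinear T"
    and cs: "cs \<in> rank_range k As" and k: "k \<ge> 2 * p * q * (length As + 1)"
  shows "star_center (matricial_range p q As) (map (\<lambda>c. c \<cdot>\<^sub>m 1\<^sub>m q) cs)"
proof (rule star_center_matricial_rangeI[OF As])
  obtain x where len: "length cs = length As" and x: "orthonormal_on {..<k} x"
    "\<And>j i i'. j < length As \<Longrightarrow> i < k \<Longrightarrow> i' < k \<Longrightarrow>
      cinner ((As ! j) (x i')) (x i) = of_bool (i = i') * cs ! j"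
    using cs unfolding rank_range_iff[OF As] by blast
  show "length (map (\<lambda>c. c \<cdot>\<^sub>m 1\<^sub>m q) cs) = length As" using len by simp
  show "set (map (\<lambda>c. c \<cdot>\<^sub>m 1\<^sub>m q) cs) \<subseteq> carrier_mat q q" by auto
  fix X :: "nat \<times> nat \<Rightarrow> 'a"
  define Z where "Z = (\<lambda>(l, a :: nat). x l)"
  have Z: "tensor_compression k 1 Z id (\<lambda>_ _. 1)"
    "\<And>j. j < length As \<Longrightarrow> tensor_compression k 1 Z (As ! j) (\<lambda>_ _. cs ! j)"
    using x by (auto simp: tensor_compression_def orthonormal_on_def Z_def)
  have "(2 * length As + 1) * card ({..<p} \<times> {..<q}) * 1 + p * q = 2 * p * q * (length As + 1)"
    by (simp add: distrib_left distrib_right mult_ac)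
  with k have "(2 * length As + 1) * card ({..<p} \<times> {..<q}) * 1 + p * q \<le> k" by (simp only:)
  from exists_tensor_subfamily[OF As _ this, of Z X]
  obtain W where W: "\<forall>T B. bounded_clinear T \<longrightarrow> tensor_compression k 1 Z T B \<longrightarrow>
      tensor_compression (p * q) 1 W T B"
    and W0: "\<forall>i<p * q. \<forall>a<1. \<forall>v\<in>{..<p} \<times> {..<q}. \<forall>\<phi>\<in>set (cross_forms As (X v)). \<phi> (W (i, a)) = 0"
    by blast
  define W' where "W' = (\<lambda>(i, a). W (i * q + a, 0))"
  have W': "tensor_compression p q W' T (\<lambda>a a'. of_bool (a = a') * c)"
    if "tensor_compression (p * q) 1 W T (\<lambda>_ _. c)" for T c
  proof -
    have "i * q + a = i' * q + a' \<longleftrightarrow> i = i' \<and> a = a'" if "a < q" "a' < q" for i i' a a'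
      using that by (rule mult_add_eq_iff)
    then show ?thesis using that by (auto simp: tensor_compression_def W'_def div_mult_add_less)
  qed
  have "tensor_orthonormal p q W'"
    using W'[OF W[rule_format, OF bounded_clinear_id Z(1)]] by (simp add: tensor_orthonormal_def)
  moreover have "tensor_compression p q W' (As ! j) (\<lambda>a a'. map (\<lambda>c. c \<cdot>\<^sub>m 1\<^sub>m q) cs ! j $$ (a, a'))"
    if j: "j < length As" for j
    using W'[OF W[rule_format, OF bspec[OF As nth_mem[OF j]] Z(2)[OF j]]] j len
    by (auto simp: tensor_compression_def)
  moreover have "\<phi> (W' (i, a)) = 0"
    if "i < p" "a < q" "v \<in> {..<p} \<times> {..<q}" "\<phi> \<in> set (cross_forms As (X v))" for i a v \<phi>
    using W0 div_mult_add_less[OF that(1,2)] that(3,4) less_numeral_extra(1)[where 'a = nat]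
    unfolding W'_def prod.case by blast
  ultimately show "\<exists>W. tensor_orthonormal p q W \<and>
      (\<forall>j<length As. tensor_compression p q W (As ! j)
        (\<lambda>a a'. map (\<lambda>c. c \<cdot>\<^sub>m 1\<^sub>m q) cs ! j $$ (a, a'))) \<and>
      (\<forall>i<p. \<forall>a<q. \<forall>v\<in>{..<p} \<times> {..<q}. \<forall>\<phi>\<in>set (cross_forms As (X v)). \<phi> (W (i, a)) = 0)"
    by blast
qed

lemma matricial_range_star_center:
  fixes As :: "('a::complex_hilbert_space \<Rightarrow> 'a) list"
  assumes As: "\<forall>T\<in>set As. bounded_clinear T"
    and Cs: "Cs \<in> matricial_range P q As" and P: "P \<ge> p * (q\<^sup>2 * (2 * length As + 1) + 1)"
  shows "star_center (matricial_range p q As) Cs"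
proof (rule star_center_matricial_rangeI[OF As])
  obtain Z where len: "length Cs = length As" "set Cs \<subseteq> carrier_mat q q"
    and Z: "tensor_orthonormal P q Z"
      "\<And>j. j < length As \<Longrightarrow> tensor_compression P q Z (As ! j) (\<lambda>a a'. Cs ! j $$ (a, a'))"
    using Cs unfolding matricial_range_iff[OF As] by blast
  show "length Cs = length As" "set Cs \<subseteq> carrier_mat q q" by (fact len)+
  fix X :: "nat \<times> nat \<Rightarrow> 'a"
  have "(2 * length As + 1) * card ({..<p} \<times> {..<q}) * q + p = p * (q\<^sup>2 * (2 * length As + 1) + 1)"
    by (simp add: algebra_simps power2_eq_square)
  with P have "(2 * length As + 1) * card ({..<p} \<times> {..<q}) * q + p \<le> P" by (simp only:)
  from exists_tensor_subfamily[OF As _ this, of Z X]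
  obtain W where W: "\<And>T B. bounded_clinear T \<Longrightarrow> tensor_compression P q Z T B \<Longrightarrow>
      tensor_compression p q W T B"
    and W0: "\<forall>i<p. \<forall>a<q. \<forall>v\<in>{..<p} \<times> {..<q}. \<forall>\<phi>\<in>set (cross_forms As (X v)). \<phi> (W (i, a)) = 0"
    by auto
  have "tensor_orthonormal p q W"
    using W[OF bounded_clinear_id] Z(1) by (simp add: tensor_orthonormal_def)
  moreover have "tensor_compression p q W (As ! j) (\<lambda>a a'. Cs ! j $$ (a, a'))" if "j < length As" for j
    using that by (intro W bspec[OF As] Z(2)) auto
  ultimately show "\<exists>W. tensor_orthonormal p q W \<and>
      (\<forall>j<length As. tensor_compression p q W (As ! j) (\<lambda>a a'. Cs ! j $$ (a, a'))) \<and>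
      (\<forall>i<p. \<forall>a<q. \<forall>v\<in>{..<p} \<times> {..<q}. \<forall>\<phi>\<in>set (cross_forms As (X v)). \<phi> (W (i, a)) = 0)"
    using W0 by blast
qed

lemma scalar_mem_matricial_range:
  fixes As :: "('a::complex_hilbert_space \<Rightarrow> 'a) list"
  assumes As: "\<forall>T\<in>set As. bounded_clinear T" and cs: "cs \<in> rank_range (p * q) As"
  shows "map (\<lambda>c. c \<cdot>\<^sub>m 1\<^sub>m q) cs \<in> matricial_range p q As"
proof -
  have "kronecker (1\<^sub>m p) (c \<cdot>\<^sub>m 1\<^sub>m q) = c \<cdot>\<^sub>m 1\<^sub>m (p * q)" for c
  proof (rule eq_matI)
    fix k l assume "k < dim_row (c \<cdot>\<^sub>m 1\<^sub>m (p * q))" "l < dim_col (c \<cdot>\<^sub>m 1\<^sub>m (p * q))"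
    then have kl: "k < p * q" "l < p * q" by simp_all
    then have "k div q < p" "k mod q < q" "l div q < p" "l mod q < q"
      by (auto simp: less_mult_imp_div_less intro!: mod_less_divisor gr0I)
    moreover have "k = l \<longleftrightarrow> k div q = l div q \<and> k mod q = l mod q" by (metis div_mult_mod_eq)
    ultimately show "kronecker (1\<^sub>m p) (c \<cdot>\<^sub>m 1\<^sub>m q) $$ (k, l) = (c \<cdot>\<^sub>m 1\<^sub>m (p * q)) $$ (k, l)"
      using kl by (cases "k = l") (auto simp: kronecker_def)
  qed (simp_all add: kronecker_def)
  then show ?thesis using cs unfolding rank_range_def matricial_range_def by fastforce
qed

theorem theorem2p8:
  fixes As :: "('h::complex_hilbert_space \<Rightarrow> 'h) list"
    and m p q :: nat
  assumes "m \<ge> 1" and "p \<ge> 1" and "q \<ge> 1"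
    and "length As = m"
    and "\<And>T. T \<in> set As \<Longrightarrow> bounded_clinear T"
  shows "(let p1 = 2 * p * q * (m + 1) in
           cdim TYPE('h) \<ge> enat ((p1 - 1) * (2 * m + 1)^2) \<longrightarrow>
             rank_range p1 As \<noteq> {} \<and>
             star_shaped (matricial_range p q As) \<and>
             (\<forall>cs \<in> rank_range p1 As.
                star_center (matricial_range p q As) (map (\<lambda>c. c \<cdot>\<^sub>m 1\<^sub>m q) cs))) \<and>
         (let p2 = p * (q^2 * (2 * m + 1) + 1) in
           cdim TYPE('h) \<ge> enat ((p2 * q - 1) * (2 * m + 1)^2) \<longrightarrow>
             matricial_range p2 q As \<noteq> {} \<and>
             star_shaped (matricial_range p q As) \<and>
             (\<forall>Cs \<in> matricial_range p2 q As.
                star_center (matricial_range p q As) Cs))"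
proof -
  have As: "\<forall>T\<in>set As. bounded_clinear T" using assms(5) by blast
  have "As \<noteq> []" using assms(1,4) by auto
  then have nonempty: "rank_range k As \<noteq> {}"
    if "k \<ge> 2" "enat ((k - 1) * (2 * m + 1)\<^sup>2) \<le> cdim TYPE('h)" for k
    using rank_range_nonempty[OF As] that assms(4) by simp
  define p1 where "p1 = 2 * p * q * (m + 1)"
  define p2 where "p2 = p * (q\<^sup>2 * (2 * m + 1) + 1)"
  have "2 * 1 * 1 * (0 + 1) \<le> p1" unfolding p1_def using assms by (intro mult_mono add_mono) auto
  then have p1: "p1 \<ge> 2" by simp
  have "1 * (1\<^sup>2 * (2 * 0 + 1) + 1) * 1 \<le> p2 * q"
    unfolding p2_def using assms by (intro mult_mono add_mono power_mono) auto
  then have p2: "p2 * q \<ge> 2" by simp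
  have 1: "star_center (matricial_range p q As) (map (\<lambda>c. c \<cdot>\<^sub>m 1\<^sub>m q) cs)"
    if "cs \<in> rank_range p1 As" for cs
    using that by (rule rank_range_star_center[OF As]) (simp_all add: p1_def assms(4))
  have 2: "star_center (matricial_range p q As) Cs" if "Cs \<in> matricial_range p2 q As" for Cs
    using that by (rule matricial_range_star_center[OF As]) (simp_all add: p2_def assms(4))
  have "rank_range p1 As \<noteq> {}" if "cdim TYPE('h) \<ge> enat ((p1 - 1) * (2 * m + 1)^2)"
    using nonempty[OF p1 that] .
  moreover have "matricial_range p2 q As \<noteq> {}" if "cdim TYPE('h) \<ge> enat ((p2 * q - 1) * (2 * m + 1)^2)"
    using nonempty[OF p2 that] scalar_mem_matricial_range[OF As, where p = p2 and q = q] by blast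
  ultimately show ?thesis
    unfolding Let_def p1_def[symmetric] p2_def[symmetric] star_shaped_def using 1 2 by blast
qed

end
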